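(* Let $(\Omega,d,\mu)$ be a metric probability space (a connected separable metric space equipped with a non-atomic Borel probability measure $\mu$) with isoperimetric profile $I=I_{(\Omega,d,\mu)}$. Assume: (Condition 1') $I$ is continuous on $[0,1]$, positive on $(0,1)$, and $I(0)=0$; (Condition 2) for every Lipschitz function $f$ on $\Omega$ and every $c\in\mathbb{R}$, $|\nabla f(x)|=0$ for $\mu$-a.e. $x$ in the set $\{x: f(x)=c\}$. Let $1\le q<\infty$. Then for every $f\in Lip(\Omega)\cap L^1(\Omega)$ and all $t\in(0,1)$: 1. $$\int_0^t\Big[\big((-f_\mu^{\ast})'(\cdot)\,I(\cdot)\big)^{\ast}(s)\Big]^q ds\le\int_0^t\big(|\nabla f|_\mu^{\ast}(s)\big)^q ds;$$ 2. $$\big(f_\mu^{\ast\ast}(t)-f_\mu^{\ast}(t)\big)\,w_q(t)\le\Big(\frac1t\int_0^t\big(|\nabla f|_\mu^{\ast}(s)\big)^q ds\Big)^{1/q}.$$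
   Context: $Lip(\Omega)$ is the set of real-valued Lipschitz functions on $\Omega$. For $f\in Lip(\Omega)$, $|\nabla f(x)|=\limsup_{d(x,y)\to0}\frac{|f(x)-f(y)|}{d(x,y)}$. For a Borel set $A\subset\Omega$, the Minkowski content is $\mu^+(A)=\liminf_{h\to0}\frac{\mu(A_h)-\mu(A)}{h}$, where $A_h=\{x\in\Omega: d(x,A)<h\}$. The isoperimetric profile $I=I_{(\Omega,d,\mu)}:[0,1]\to[0,\infty)$ is the pointwise maximal function such that $\mu^+(A)\ge I(\mu(A))$ for all Borel sets $A$. For measurable $u:\Omega\to\mathbb{R}$: $\mu_u(t)=\mu\{x:|u(x)|>t\}$; the decreasing rearrangement is $u_\mu^{\ast}(s)=\inf\{t\ge0:\mu_u(t)\le s\}$ for $s\in(0,1)$; and $u_\mu^{\ast\ast}(t)=\frac1t\int_0^t u_\mu^{\ast}(s)\,ds$. For a measurable function $h$ on $(0,1)$, $h^{\ast}$ denotes its decreasing rearrangement with respect to Lebesgue measure on $(0,1)$. $(-f_\mu^{\ast})'$ is the (a.e. defined) derivative of $-f_\mu^{\ast}$. The function $w_q$ is defined, for $t\in(0,1)$, by $$w_q(t)=\Big(\frac1t\int_0^t\Big(\frac{s}{I(s)}\Big)^{\frac{q}{q-1}}ds\Big)^{\frac{1-q}{q}}\ \text{ if } q>1,\qquad w_1(t)=\inf_{0<s<t}\frac{I(s)}{s},$$ with the convention $w_q(t)=0$ if the integral is infinite. *)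

theory Defs
  imports "HOL-Probability.Probability"
begin

definition nonatomic :: "'a measure \<Rightarrow> bool" where
  "nonatomic M \<longleftrightarrow>
     (\<forall>A\<in>sets M. emeasure M A > 0 \<longrightarrow>
        (\<exists>B\<in>sets M. B \<subseteq> A \<and> 0 < emeasure M B \<and> emeasure M B < emeasure M A))"

text \<open>The metric space is the whole type; the measure lives on its Borel sigma-algebra,
  so \<open>space M = UNIV\<close>.\<close>

definition metric_probability_space :: "'a::metric_space measure \<Rightarrow> bool" where
  "metric_probability_space M \<longleftrightarrow>
     connected (UNIV :: 'a set) \<and> separable_space (euclidean :: 'a topology) \<and>
     prob_space M \<and> sets M = sets borel \<and> nonatomic M"

definition Lip :: "('a::metric_space \<Rightarrow> real) set" where
  "Lip = {f. \<exists>L. L-lipschitz_on UNIV f}"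

text \<open>The upper limit is taken in the extended reals; it is finite for Lipschitz \<open>f\<close>
  at points that are not isolated, and a metric probability space has no isolated points.\<close>

definition grad_norm :: "('a::metric_space \<Rightarrow> real) \<Rightarrow> 'a \<Rightarrow> real" where
  "grad_norm f x = real_of_ereal (Limsup (at x) (\<lambda>y. ereal (\<bar>f x - f y\<bar> / dist x y)))"

text \<open>The distance to a set is an infimum in the extended reals, so that the distance to the
  empty set is infinite and the empty set has empty neighbourhoods.
  With \<open>infdist\<close>, which is 0 for the empty set, the empty set would have infinite
  Minkowski content.\<close>

definition nbhd :: "'a::metric_space set \<Rightarrow> real \<Rightarrow> 'a set" where
  "nbhd A h = {x. (INF a\<in>A. ereal (dist x a)) < ereal h}"

definition minkowski_content :: "'a::metric_space measure \<Rightarrow> 'a set \<Rightarrow> ereal" where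
  "minkowski_content M A =
     Liminf (at_right 0) (\<lambda>h. ereal ((measure M (nbhd A h) - measure M A) / h))"

definition isoperimetric_minorant :: "'a::metric_space measure \<Rightarrow> (real \<Rightarrow> real) \<Rightarrow> bool" where
  "isoperimetric_minorant M J \<longleftrightarrow>
     (\<forall>s\<in>{0..1}. 0 \<le> J s) \<and>
     (\<forall>A\<in>sets borel. ereal (J (measure M A)) \<le> minkowski_content M A)"

text \<open>The profile is a function on \<open>[0,1]\<close>; values outside this interval are irrelevant.\<close>

definition isoperimetric_profile :: "'a::metric_space measure \<Rightarrow> (real \<Rightarrow> real) \<Rightarrow> bool" where
  "isoperimetric_profile M I \<longleftrightarrow>
     isoperimetric_minorant M I \<and>
     (\<forall>J. isoperimetric_minorant M J \<longrightarrow> (\<forall>s\<in>{0..1}. J s \<le> I s))"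

definition distr_fun :: "'a measure \<Rightarrow> ('a \<Rightarrow> real) \<Rightarrow> real \<Rightarrow> real" where
  "distr_fun M u t = measure M {x\<in>space M. \<bar>u x\<bar> > t}"

definition rearr :: "'a measure \<Rightarrow> ('a \<Rightarrow> real) \<Rightarrow> real \<Rightarrow> real" where
  "rearr M u s = Inf {t. 0 \<le> t \<and> distr_fun M u t \<le> s}"

text \<open>Only meaningful for integrable \<open>u\<close>, for which \<open>rearr M u\<close> is integrable on \<open>(0,1)\<close>.\<close>

definition rearr_avg :: "'a measure \<Rightarrow> ('a \<Rightarrow> real) \<Rightarrow> real \<Rightarrow> real" where
  "rearr_avg M u t = (1 / t) * (LINT s:{0<..<t}|lborel. rearr M u s)"

definition isoperimetric_weight :: "(real \<Rightarrow> real) \<Rightarrow> real \<Rightarrow> real \<Rightarrow> real" where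
  "isoperimetric_weight I q t =
     (if q = 1 then INF s\<in>{0<..<t}. I s / s
      else let J = (\<integral>\<^sup>+s\<in>{0<..<t}. ennreal ((s / I s) powr (q / (q - 1))) \<partial>lborel)
           in if J = \<infinity> then 0 else ((1 / t) * enn2real J) powr ((1 - q) / q))"

end

theory Submission
  imports Defs
begin

text \<open>
  Write \<open>\<phi>\<close> for the rearrangement \<open>f\<^sub>\<mu>\<^sup>*\<close>, \<open>H\<close> for \<open>|\<nabla>f|\<close> and \<open>\<mu>\<^sub>f\<close> for the distribution
  function of \<open>f\<close>.  Both inequalities come from comparing, for \<open>0 < a < b < 1\<close>, the drop
  \<open>\<phi> a - \<phi> b\<close> with the integral of \<open>H\<close> over the shell \<open>\<phi> b < |f| < \<phi> a\<close>.

  The isoperimetric inequality, applied to the superlevel sets of a Lipschitz function \<open>u\<close>, gives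
  the coarea inequality \<open>\<integral> I (\<mu>{u > s}) ds \<le> \<integral> |\<nabla>u| d\<mu>\<close> (\<open>coarea_inequality\<close>).  For \<open>u\<close> take \<open>|f|\<close>
  truncated between two levels \<open>c < d\<close>: by Condition 2 the gradient of \<open>u\<close> vanishes almost
  everywhere on the sets \<open>{u = c}\<close> and \<open>{u = d}\<close>, so that
  \<open>\<integral>\<^bsub>c\<^esub>\<^bsup>d\<^esup> I (\<mu>\<^sub>f s) ds \<le> \<integral>\<^bsub>{c < |f| < d}\<^esub> H d\<mu>\<close> (\<open>profile_level_integral_le\<close>).  If \<open>c = \<phi> b\<close> and
  \<open>d = \<phi> a\<close>, then \<open>\<mu>\<^sub>f s\<close> lies in \<open>[a,b]\<close> for every level \<open>s\<close> in between, and the shell has measure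
  at most \<open>b - a\<close>.  Hence \<open>min\<^bsub>[a,b]\<^esub> I \<cdot> (\<phi> a - \<phi> b) \<le> \<integral>\<^bsub>shell\<^esub> H\<close>.  This has two consequences.

  First, \<open>H\<close> is bounded by the Lipschitz constant of \<open>f\<close> and \<open>I\<close> is bounded below on compact
  subintervals of \<open>(0,1)\<close>, so \<open>\<phi>\<close> is locally Lipschitz there.  It is therefore differentiable almost
  everywhere (\<open>lipschitz_AE_differentiable\<close>) and is an integral of its derivative
  (\<open>lipschitz_FTC\<close>).

  Second, subtract \<open>k (b - a)\<close> on both sides, add over the intervals of a partition (their shells
  are disjoint) and refine the partition.  With \<open>G = (-\<phi>') I\<close>, Fatou's lemma yields
  \<open>\<integral> (G - k)\<^sup>+ \<le> \<integral> (H - k)\<^sup>+\<close> for every \<open>k \<ge> 0\<close> (\<open>excess_slope_integral_le\<close>).  Integrals of this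
  kind do not change under rearrangement, and the family of these inequalities says exactly that
  \<open>G\<^sup>*\<close> is weakly majorized by the rearrangement of \<open>H\<close>; the Hardy-Littlewood-Polya inequality for
  \<open>x \<mapsto> x\<^sup>q\<close> is the first claim (\<open>majorization\<close>).

  For the second claim, Fubini's theorem gives
  \<open>t (f\<^sub>\<mu>\<^sup>*\<^sup>* t - f\<^sub>\<mu>\<^sup>* t) = \<integral>\<^sub>0\<^sup>t (\<phi> s - \<phi> t) ds = \<integral>\<^sub>0\<^sup>t r (-\<phi>' r) dr = \<integral>\<^sub>0\<^sup>t (r / I r) G r dr\<close>,
  and Hoelder's inequality separates the factor \<open>r / I r\<close>, which is what the weight \<open>w\<^sub>q\<close> measures,
  from \<open>G\<close>, whose \<open>q\<close>-th power has already been estimated.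
\<close>

section \<open>Lipschitz functions of a real variable\<close>

text \<open>The Stieltjes measures of \<open>g\<close> and of \<open>x - g x\<close> add up to Lebesgue measure, since they do so on
  intervals.  In particular the Stieltjes measure of \<open>g\<close> is absolutely continuous, and a lower bound
  for it is the same as an upper bound for the measure of the complementary function.\<close>

lemma interval_measure_add_complement:
  fixes g :: "real \<Rightarrow> real"
  assumes mono: "\<And>x y. x \<le> y \<Longrightarrow> g x \<le> g y"
    and lip: "\<And>x y. x \<le> y \<Longrightarrow> g y - g x \<le> y - x"
    and A: "A \<in> sets borel"
  shows "emeasure (interval_measure g) A + emeasure (interval_measure (\<lambda>x. x - g x)) A
         = emeasure lborel A"
proof -
  define \<nu> where "\<nu> = interval_measure g"
  define \<kappa> where "\<kappa> = interval_measure (\<lambda>x. x - g x)"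
  define \<sigma> where "\<sigma> = measure_of UNIV (sets borel) (\<lambda>A. emeasure \<nu> A + emeasure \<kappa> A)"
  have sets\<nu>: "sets \<nu> = sets borel" "sets \<kappa> = sets borel"
    by (auto simp: \<nu>_def \<kappa>_def)
  have "isCont g x" for x
  proof -
    have "1-lipschitz_on UNIV g"
      by (rule lipschitz_onI) (smt (verit) lip mono dist_real_def)+
    then show ?thesis
      using lipschitz_on_continuous_on continuous_on_eq_continuous_at open_UNIV by blast
  qed
  then have cont: "continuous_on UNIV g" "continuous_on UNIV (\<lambda>x. x - g x)"
    by (auto simp: continuous_on_eq_continuous_at intro!: continuous_intros)
  have mono': "x - g x \<le> y - g y" if "x \<le> y" for x y
    using lip[OF that] by simp
  have Ioo: "emeasure (interval_measure F) {l<..<u} = F u - F l"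
    if "l \<le> u" and F: "\<And>x y. x \<le> y \<Longrightarrow> F x \<le> F y" "continuous_on UNIV F" for F :: "real \<Rightarrow> real" and l u
  proof -
    have "isCont F a" for a using F(2) by (simp add: continuous_on_eq_continuous_at)
    then have rc: "\<And>a. continuous (at_right a) F" by (simp add: continuous_at_imp_continuous_at_within)
    have 1: "emeasure (interval_measure F) {u..u} = 0"
      using emeasure_interval_measure_Icc[of u u F] F by simp
    have "emeasure (interval_measure F) ({l<..<u} \<union> {u..u}) = emeasure (interval_measure F) {l<..<u}"
      using 1 by (intro emeasure_Un_null_set) (auto simp: null_sets_def)
    moreover have "emeasure (interval_measure F) {l<..u} = F u - F l"
      using emeasure_interval_measure_Ioc[OF that(1) F(1) rc] by simp
    moreover have "l < u \<Longrightarrow> {l<..u} = {l<..<u} \<union> {u..u}" by auto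
    ultimately show ?thesis using that(1) by (cases "l = u") auto
  qed
  have sig: "emeasure \<sigma> B = emeasure \<nu> B + emeasure \<kappa> B" if "B \<in> sets borel" for B
  proof -
    have "sigma_algebra UNIV (sets (borel::real measure))"
      using sets.sigma_algebra_axioms[of "borel::real measure"] by simp
    moreover have "positive (sets borel) (\<lambda>A. emeasure \<nu> A + emeasure \<kappa> A)"
      by (simp add: positive_def)
    moreover have "countably_additive (sets borel) (\<lambda>A. emeasure \<nu> A + emeasure \<kappa> A)"
      unfolding countably_additive_def
      by (auto simp: suminf_add[symmetric] suminf_emeasure sets\<nu>)
    ultimately show ?thesis unfolding \<sigma>_def
      by (intro emeasure_measure_of_sigma that)
  qed
  have "lborel = \<sigma>"
  proof (rule lborel_eqI)
    fix l u :: real assume *: "\<And>b. b \<in> Basis \<Longrightarrow> l \<bullet> b \<le> u \<bullet> b"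
    then have lu: "l \<le> u" by simp
    have "emeasure \<sigma> {l<..<u} = ennreal (g u - g l) + ennreal ((u - g u) - (l - g l))"
      by (subst sig) (auto simp: \<nu>_def \<kappa>_def Ioo[OF lu mono cont(1)] Ioo[OF lu mono' cont(2)])
    also have "\<dots> = ennreal (u - l)"
      using mono[OF lu] mono'[OF lu] by (subst ennreal_plus[symmetric]) auto
    finally show "emeasure \<sigma> (box l u) = (\<Prod>b\<in>Basis. (u - l) \<bullet> b)"
      using lu by simp
  next
    show "sets \<sigma> = sets borel" unfolding \<sigma>_def
      by (simp add: sets.sigma_sets_eq[of borel, simplified])
  qed
  then show ?thesis using sig[OF A] by (simp add: \<nu>_def \<kappa>_def)
qed

text \<open>By Vitali's covering theorem, an open set slightly larger than \<open>A\<close> contains disjoint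
  intervals on which \<open>g\<close> increases at a rate below \<open>u\<close> and which cover \<open>A\<close> up to a Lebesgue null set.
  This null set is also null for the Stieltjes measure of \<open>g\<close>.\<close>

lemma interval_measure_le_of_small_quotients:
  fixes g :: "real \<Rightarrow> real"
  assumes mono: "\<And>x y. x \<le> y \<Longrightarrow> g x \<le> g y"
    and lip: "\<And>x y. x \<le> y \<Longrightarrow> g y - g x \<le> y - x"
    and A: "A \<in> sets borel" and u: "0 \<le> u"
    and quot: "\<And>x d. x \<in> A \<Longrightarrow> 0 < d \<Longrightarrow> \<exists>a b. a < x \<and> x < b \<and> b - a < d \<and> g b - g a < u * (b - a)"
  shows "emeasure (interval_measure g) A \<le> ennreal u * emeasure lborel A"
proof -
  define \<nu> where "\<nu> = interval_measure g"
  have sets\<nu>[measurable_cong, simp]: "sets \<nu> = sets borel" by (simp add: \<nu>_def)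
  have cont: "continuous_on UNIV g"
  proof -
    have "1-lipschitz_on UNIV g"
      by (rule lipschitz_onI) (smt (verit) lip mono dist_real_def)+
    then show ?thesis using lipschitz_on_continuous_on by blast
  qed
  have le: "emeasure \<nu> B \<le> emeasure lborel B" if "B \<in> sets borel" for B
    using interval_measure_add_complement[OF mono lip that] 
    by (simp add: \<nu>_def) (metis add.commute le_iff_add)
  have "emeasure \<nu> A \<le> ennreal u * emeasure lborel A + ennreal e" if e: "e > 0" for e
  proof -
    define e' where "e' = e / (u + 1)"
    have e': "e' > 0" "u * e' \<le> e" using e u by (auto simp: e'_def field_simps)
    \<comment> \<open>Lebesgue excess \<open>e / (u + 1)\<close> costs less than \<open>e\<close> after multiplication by \<open>u\<close>\<close>
    obtain U where U: "open U" "A \<subseteq> U" "emeasure lborel (U - A) < ennreal e'"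
      using outer_regular_lborel[OF A e'(1)] by metis
    define K where "K = {(a,b). a < b \<and> {a..b} \<subseteq> U \<and> g b - g a < u * (b - a)}"
    define c where "c = (\<lambda>(a::real,b). (a + b)/2)"
    define r where "r = (\<lambda>(a::real,b). (b - a)/2)"
    have cb: "cball (c p) (r p) = {fst p..snd p}" for p
      by (cases p) (auto simp: c_def r_def cball_eq_atLeastAtMost field_simps)
    obtain C where C: "countable C" "C \<subseteq> K"
      "pairwise (\<lambda>i j. disjnt (cball (c i) (r i)) (cball (c j) (r j))) C"
      "negligible (A - (\<Union>i\<in>C. cball (c i) (r i)))"
    proof (rule Vitali_covering_theorem_cballs[of K r A c])
      show "0 < r i" if "i \<in> K" for i using that by (auto simp: K_def r_def)
      fix x d :: real assume x: "x \<in> A" and d: "0 < d"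
      from x U have "x \<in> U" by auto
      with U obtain d' where d': "d' > 0" "ball x d' \<subseteq> U" by (meson openE)
      obtain a b where ab: "a < x" "x < b" "b - a < min d d'" "g b - g a < u * (b - a)"
        using quot[OF x, of "min d d'"] d d' by auto
      have "{a..b} \<subseteq> ball x d'" using ab by (auto simp: dist_real_def)
      then have "(a,b) \<in> K" using ab d' by (auto simp: K_def)
      moreover have "x \<in> cball (c (a,b)) (r (a,b))" using ab by (auto simp: cb)
      moreover have "r (a,b) < d" using ab by (auto simp: r_def)
      ultimately show "\<exists>i. i \<in> K \<and> x \<in> cball (c i) (r i) \<and> r i < d" by blast
    qed
    have disj: "disjoint_family_on (\<lambda>i. {fst i..snd i}) C"
      using C(3) unfolding cb disjoint_family_on_def pairwise_def disjnt_def by auto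
    define W where "W = (\<Union>i\<in>C. {fst i..snd i})"
    have W[measurable]: "W \<in> sets borel" unfolding W_def using C(1) by auto
    have N: "emeasure lborel (A - W) = 0"
    proof -
      have AW: "A - W \<in> sets borel" using A by auto
      then have "emeasure lebesgue (A - W) = 0"
        using C(4) negligible_iff_emeasure0[of "A - W"] by (auto simp: W_def cb)
      then show ?thesis using AW by (simp add: emeasure_completion)
    qed
    have "emeasure \<nu> W = (\<integral>\<^sup>+i. emeasure \<nu> {fst i..snd i} \<partial>count_space C)"
      unfolding W_def by (rule emeasure_UN_countable) (use C disj in auto)
    also have "\<dots> \<le> (\<integral>\<^sup>+i. ennreal u * emeasure lborel {fst i..snd i} \<partial>count_space C)"
    proof (rule nn_integral_mono)
      fix i assume "i \<in> space (count_space C)"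
      then have i: "fst i < snd i" "g (snd i) - g (fst i) < u * (snd i - fst i)" using C(2) by (auto simp: K_def)
      have "emeasure \<nu> {fst i..snd i} = ennreal (g (snd i) - g (fst i))"
        unfolding \<nu>_def by (rule emeasure_interval_measure_Icc) (use i mono cont in auto)
      also have "\<dots> \<le> ennreal (u * (snd i - fst i))" using i by (intro ennreal_leI) auto
      also have "\<dots> = ennreal u * emeasure lborel {fst i..snd i}" using i u by (simp add: ennreal_mult)
      finally show "emeasure \<nu> {fst i..snd i} \<le> ennreal u * emeasure lborel {fst i..snd i}" .
    qed
    also have "\<dots> = ennreal u * (\<integral>\<^sup>+i. emeasure lborel {fst i..snd i} \<partial>count_space C)"
      by (rule nn_integral_cmult) auto
    also have "(\<integral>\<^sup>+i. emeasure lborel {fst i..snd i} \<partial>count_space C) = emeasure lborel W"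
      unfolding W_def by (rule emeasure_UN_countable[symmetric]) (use C disj in auto)
    also have "\<dots> \<le> emeasure lborel U"
      by (rule emeasure_mono) (use C(2) U in \<open>auto simp: W_def K_def\<close>, fastforce)
    also have "emeasure lborel U = emeasure lborel (A \<union> (U - A))" using U by (simp add: Un_absorb1)
    also have "\<dots> \<le> emeasure lborel A + emeasure lborel (U - A)"
      by (rule emeasure_subadditive) (use A U in auto)
    also have "\<dots> \<le> emeasure lborel A + ennreal e'" using U by (intro add_left_mono) auto
    finally have "emeasure \<nu> W \<le> ennreal u * (emeasure lborel A + ennreal e')" 
      by (simp add: mult_left_mono)
    also have "\<dots> = ennreal u * emeasure lborel A + ennreal (u * e')"
      using u e' by (simp add: distrib_left ennreal_mult)
    also have "\<dots> \<le> ennreal u * emeasure lborel A + ennreal e"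
      using e' by (intro add_left_mono ennreal_leI) auto
    finally have 1: "emeasure \<nu> W \<le> ennreal u * emeasure lborel A + ennreal e" .
    have "emeasure \<nu> A \<le> emeasure \<nu> (W \<union> (A - W))" by (rule emeasure_mono) (use A in auto)
    also have "\<dots> \<le> emeasure \<nu> W + emeasure \<nu> (A - W)"
      by (rule emeasure_subadditive) (use A in auto)
    also have "emeasure \<nu> (A - W) = 0" using le[of "A - W"] N A by auto
    finally show ?thesis using 1 by simp
  qed
  then have "emeasure \<nu> A \<le> ennreal u * emeasure lborel A"
    by (rule ennreal_le_epsilon)
  then show ?thesis by (simp only: \<nu>_def)
qed

text \<open>If \<open>g\<close> fails to be differentiable at \<open>x\<close>, there are rationals \<open>u < v\<close> such that arbitrarily
  short intervals around \<open>x\<close> have difference quotients below \<open>u\<close>, and others have quotients above \<open>v\<close>.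
  On the set \<open>A\<close> of these points with \<open>|x| \<le> m\<close>, the preceding lemma bounds the Stieltjes measure of
  \<open>g\<close> by \<open>u |A|\<close> and that of \<open>x - g x\<close> by \<open>(1 - v) |A|\<close>.  Their sum is \<open>|A|\<close>, so \<open>|A| \<le> (1 - (v - u)) |A|\<close>
  and \<open>A\<close> is null.\<close>

lemma mono_1_lipschitz_AE_differentiable:
  fixes g :: "real \<Rightarrow> real"
  assumes mono: "\<And>x y. x \<le> y \<Longrightarrow> g x \<le> g y"
    and lip: "\<And>x y. x \<le> y \<Longrightarrow> g y - g x \<le> y - x"
  shows "AE x in lborel. g differentiable (at x)"
proof -
  define P where "P v x \<longleftrightarrow> (\<forall>d>0. \<exists>a b. a < x \<and> x < b \<and> b - a < d \<and> v * (b - a) < g b - g a)" for v x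
  define Q where "Q v x \<longleftrightarrow> (\<forall>d>0. \<exists>a b. a < x \<and> x < b \<and> b - a < d \<and> g b - g a < v * (b - a))" for v x
  have cont: "continuous_on UNIV g"
  proof -
    have "1-lipschitz_on UNIV g"
      by (rule lipschitz_onI) (smt (verit) lip mono dist_real_def)+
    then show ?thesis using lipschitz_on_continuous_on by blast
  qed
  \<comment> \<open>the straddling intervals are open, so these sets are countable intersections of open sets\<close>
  have Gdelta: "{x. \<forall>d>0. \<exists>a b. a < x \<and> x < b \<and> b - a < d \<and> R a b} \<in> sets borel" for R :: "real \<Rightarrow> real \<Rightarrow> bool"
  proof -
    have "{x. \<forall>d>0. \<exists>a b. a < x \<and> x < b \<and> b - a < d \<and> R a b}
        = (\<Inter>n. \<Union>{{a<..<b} |a b. b - a < 1 / real (Suc n) \<and> R a b})" (is "?l = ?r")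
    proof safe
      fix x n assume "\<forall>d>0. \<exists>a b. a < x \<and> x < b \<and> b - a < d \<and> R a b"
      then obtain a b where "a < x" "x < b" "b - a < 1 / real (Suc n)" "R a b"
        by (meson of_nat_0_less_iff zero_less_Suc zero_less_divide_1_iff)
      then show "x \<in> \<Union>{{a<..<b} |a b. b - a < 1 / real (Suc n) \<and> R a b}"
        by (intro UnionI[of "{a<..<b}"]) auto
    next
      fix x d :: real assume x: "x \<in> ?r" and d: "0 < d"
      obtain n where n: "1 / real (Suc n) < d" using d nat_approx_posE by blast
      from x obtain a b where "x \<in> {a<..<b}" "b - a < 1 / real (Suc n)" "R a b" by blast
      then show "\<exists>a b. a < x \<and> x < b \<and> b - a < d \<and> R a b" using n by (intro exI[of _ a] exI[of _ b]) auto
    qed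
    moreover have "?r \<in> sets borel"
      by (rule sets.countable_INT'') (auto intro!: borel_open open_Union)
    ultimately show ?thesis by simp
  qed
  have PQ[measurable]: "{x. P v x} \<in> sets borel" "{x. Q v x} \<in> sets borel" for v
    unfolding P_def Q_def by (rule Gdelta)+
  have null: "{x. P v x} \<inter> {x. Q u x} \<inter> {-m..m} \<in> null_sets lborel" if uv: "u < v" for u v m :: real
  \<comment> \<open>difference quotients lie in \<open>[0,1]\<close>, so the set is empty for \<open>u < 0\<close> and for \<open>v > 1\<close>\<close>
  proof (cases "0 \<le> u \<and> v \<le> 1 \<and> 0 \<le> m")
    case False
    have nQ: "\<not> Q u x" if "u < 0" for x
    proof
      assume "Q u x"
      then obtain a b where "a < x" "x < b" "g b - g a < u * (b - a)"
        unfolding Q_def by (meson zero_less_one)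
      moreover from this have "u * (b - a) < 0" using that by (simp add: mult_neg_pos)
      ultimately show False using mono[of a b] by auto
    qed
    have nP: "\<not> P v x" if "v > 1" for x
    proof
      assume "P v x"
      then obtain a b where "a < x" "x < b" "v * (b - a) < g b - g a"
        unfolding P_def by (meson zero_less_one)
      moreover from this have "v * (b - a) > 1 * (b - a)" using that by (intro mult_strict_right_mono) auto
      ultimately show False using lip[of a b] by (smt (verit))
    qed
    from False consider "u < 0" | "v > 1" | "m < 0" by linarith
    then have "{x. P v x} \<inter> {x. Q u x} \<inter> {-m..m} = {}" using nQ nP by cases auto
    then show ?thesis by simp
  next
    case True
    define A where "A = {x. P v x} \<inter> {x. Q u x} \<inter> {-m..m}"
    have A: "A \<in> sets borel" unfolding A_def by measurable
    have "emeasure lborel A \<le> emeasure lborel {-m..m}" unfolding A_def by (intro emeasure_mono) auto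
    also have "\<dots> < \<infinity>" using True by simp
    finally obtain l where l: "emeasure lborel A = ennreal l" "0 \<le> l" 
      using ennreal_cases by (metis infinity_ennreal_def less_irrefl)
    have "emeasure (interval_measure g) A \<le> ennreal u * emeasure lborel A"
      by (rule interval_measure_le_of_small_quotients[OF mono lip A])
        (use True in \<open>auto simp: A_def Q_def\<close>)
    moreover have "emeasure (interval_measure (\<lambda>x. x - g x)) A \<le> ennreal (1 - v) * emeasure lborel A"
    proof (rule interval_measure_le_of_small_quotients[OF _ _ A])
      fix x d :: real assume "x \<in> A" "0 < d"
      then obtain a b where "a < x" "x < b" "b - a < d" "v * (b - a) < g b - g a"
        unfolding A_def P_def by blast
      then show "\<exists>a b. a < x \<and> x < b \<and> b - a < d \<and> b - g b - (a - g a) < (1 - v) * (b - a)"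
        by (intro exI[of _ a] exI[of _ b]) (auto simp: algebra_simps)
    next
      fix x y :: real assume "x \<le> y" then show "x - g x \<le> y - g y" "y - g y - (x - g x) \<le> y - x"
        using lip[of x y] mono[of x y] by auto
    qed (use True in auto)
    ultimately have "emeasure lborel A \<le> ennreal u * emeasure lborel A + ennreal (1 - v) * emeasure lborel A"
      using interval_measure_add_complement[OF mono lip A] by (metis add_mono)
    also have "\<dots> = ennreal ((u + (1 - v)) * l)" 
      using l True by (simp add: ennreal_mult[symmetric] ennreal_plus[symmetric] distrib_right del: ennreal_plus)
    finally have "l \<le> (u + (1 - v)) * l" using l True by (subst (asm) l(1)) (auto simp: ennreal_le_iff)
    then have "(v - u) * l \<le> 0" by (simp add: algebra_simps)
    with uv l have "l = 0" by (simp add: mult_le_0_iff)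
    then show ?thesis using l A unfolding A_def by (auto simp: null_sets_def)
  qed
  have diff: "g differentiable (at x)" if H: "\<And>u v. u \<in> \<rat> \<Longrightarrow> v \<in> \<rat> \<Longrightarrow> u < v \<Longrightarrow> \<not> (P v x \<and> Q u x)" for x
  proof -
    have PQ': "\<not> (P v x \<and> Q u x)" if uv: "u < v" for u v
    proof
      assume A: "P v x \<and> Q u x"
      obtain u' where u': "u' \<in> \<rat>" "u < u'" "u' < (u+v)/2" using Rats_dense_in_real[of u "(u+v)/2"] uv by auto
      obtain v' where v': "v' \<in> \<rat>" "(u+v)/2 < v'" "v' < v" using Rats_dense_in_real[of "(u+v)/2" v] uv by auto
      have "P v' x" unfolding P_def
      proof (intro allI impI)
        fix d :: real assume "0 < d"
        then obtain a b where ab: "a < x" "x < b" "b - a < d" "v * (b - a) < g b - g a" using A P_def by blast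
        have "v' * (b - a) < g b - g a"
          by (rule le_less_trans[OF mult_right_mono ab(4)]) (use v' ab in auto)
        with ab show "\<exists>a b. a < x \<and> x < b \<and> b - a < d \<and> v' * (b - a) < g b - g a" by blast
      qed
      moreover have "Q u' x" unfolding Q_def
      proof (intro allI impI)
        fix d :: real assume "0 < d"
        then obtain a b where ab: "a < x" "x < b" "b - a < d" "g b - g a < u * (b - a)" using A Q_def by blast
        have "g b - g a < u' * (b - a)"
          by (rule less_le_trans[OF ab(4) mult_right_mono]) (use u' ab in auto)
        with ab show "\<exists>a b. a < x \<and> x < b \<and> b - a < d \<and> g b - g a < u' * (b - a)" by blast
      qed
      ultimately show False using H[of u' v'] u' v' by auto
    qed
    have P_neg: "P (-1) x" unfolding P_def
    proof (intro allI impI)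
      fix d :: real assume "0 < d"
      then show "\<exists>a b. a < x \<and> x < b \<and> b - a < d \<and> - 1 * (b - a) < g b - g a"
        using mono[of "x - d/3" "x + d/3"]
        by (intro exI[of _ "x - d/3"] exI[of _ "x + d/3"]) auto
    qed
    have P_bd: "v \<le> 1" if "P v x" for v
    proof (rule ccontr)
      assume "\<not> v \<le> 1"
      from that obtain a b where "a < x" "x < b" "v * (b - a) < g b - g a"
        unfolding P_def by (meson zero_less_one)
      moreover from this have "v * (b - a) > 1 * (b - a)" using \<open>\<not> v \<le> 1\<close> by (intro mult_strict_right_mono) auto
      ultimately show False using lip[of a b] by (smt (verit))
    qed
    define D where "D = Sup {v. P v x}"
    have bdd: "bdd_above {v. P v x}" using P_bd by (auto intro!: bdd_aboveI[of _ 1])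
    have "((\<lambda>y. (g y - g x) / (y - x)) \<longlongrightarrow> D) (at x)"
    proof (rule LIM_I)
      fix r :: real assume r: "0 < r"
      define e where "e = r / 3"
      have e: "e > 0" "2 * e < r" using r by (auto simp: e_def)
      have "\<not> P (D + e) x"
      proof
        assume "P (D + e) x"
        then have "D + e \<le> D" unfolding D_def using bdd by (intro cSup_upper) auto
        with e show False by simp
      qed
      then obtain d1 where d1: "d1 > 0" "\<And>a b. a < x \<Longrightarrow> x < b \<Longrightarrow> b - a < d1 \<Longrightarrow> g b - g a \<le> (D + e) * (b - a)"
        unfolding P_def by (metis not_less)
      obtain v where v: "P v x" "D - e < v"
        using less_cSupD[of "{v. P v x}" "D - e"] P_neg e by (auto simp: D_def)
      have "\<not> Q (D - e) x" using PQ'[OF v(2)] v(1) by auto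
      then obtain d2 where d2: "d2 > 0" "\<And>a b. a < x \<Longrightarrow> x < b \<Longrightarrow> b - a < d2 \<Longrightarrow> (D - e) * (b - a) \<le> g b - g a"
        unfolding Q_def by (metis not_less)
      define d where "d = min d1 d2 / 2"
      have d: "d > 0" using d1 d2 by (auto simp: d_def)
      have ct: "(g \<longlongrightarrow> g x) (at x within S)" for S
        using cont by (metis continuous_on_eq_continuous_at isCont_def open_UNIV UNIV_I tendsto_within_subset subset_UNIV)
      \<comment> \<open>\<open>x\<close> may be an endpoint of the interval: approach it by straddling intervals and use continuity\<close>
      have bound: "(D - e) * (b - a) \<le> g b - g a \<and> g b - g a \<le> (D + e) * (b - a)"
        if ab: "a \<le> x" "x \<le> b" "b - a < d" "a < b" for a b
      proof (cases "a < x")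
        case True
        show ?thesis
        proof (cases "x < b")
          case True
          with \<open>a < x\<close> ab d1(2)[of a b] d2(2)[of a b] d1(1) d2(1) show ?thesis by (auto simp: d_def)
        next
          case False
          then have b: "b = x" using ab by auto
          have ev: "\<forall>\<^sub>F y in at_right x. y \<in> {x<..<x + d}"
            using d by (intro eventually_at_right_real) auto
          have lim: "((\<lambda>y. g y - g a) \<longlongrightarrow> g x - g a) (at_right x)" by (intro tendsto_intros ct)
          have "(D - e) * (x - a) \<le> g x - g a"
            by (rule tendsto_le[OF _ lim, of "\<lambda>y. (D - e) * (y - a)"]) 
              (auto intro!: tendsto_eq_intros eventually_mono[OF ev] d2(2) simp: d_def, use ab b \<open>a < x\<close> in \<open>auto simp: d_def\<close>)
          moreover have "g x - g a \<le> (D + e) * (x - a)"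
            by (rule tendsto_le[OF _ _ lim, of "\<lambda>y. (D + e) * (y - a)"]) 
              (auto intro!: tendsto_eq_intros eventually_mono[OF ev] d1(2) simp: d_def, use ab b \<open>a < x\<close> in \<open>auto simp: d_def\<close>)
          ultimately show ?thesis by (simp add: b)
        qed
      next
        case False
        then have a: "a = x" using ab by auto
        have ev: "\<forall>\<^sub>F y in at_left x. y \<in> {x - d<..<x}"
          using d by (intro eventually_at_left_real) auto
        have lim: "((\<lambda>y. g b - g y) \<longlongrightarrow> g b - g x) (at_left x)" by (intro tendsto_intros ct)
        have "(D - e) * (b - x) \<le> g b - g x"
          by (rule tendsto_le[OF _ lim, of "\<lambda>y. (D - e) * (b - y)"]) 
            (auto intro!: tendsto_eq_intros eventually_mono[OF ev] d2(2) simp: d_def, use ab a in \<open>auto simp: d_def\<close>)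
        moreover have "g b - g x \<le> (D + e) * (b - x)"
          by (rule tendsto_le[OF _ _ lim, of "\<lambda>y. (D + e) * (b - y)"]) 
            (auto intro!: tendsto_eq_intros eventually_mono[OF ev] d1(2) simp: d_def, use ab a in \<open>auto simp: d_def\<close>)
        ultimately show ?thesis by (simp add: a)
      qed
      show "\<exists>s>0. \<forall>y. y \<noteq> x \<and> norm (y - x) < s \<longrightarrow> norm ((g y - g x) / (y - x) - D) < r"
      proof (intro exI[of _ d] conjI allI impI d)
        fix y assume y: "y \<noteq> x \<and> norm (y - x) < d"
        have "(D - e) \<le> (g y - g x) / (y - x) \<and> (g y - g x) / (y - x) \<le> D + e"
        proof (cases "y < x")
          case True
          have "(g y - g x) / (y - x) = (g x - g y) / (x - y)" by (metis minus_diff_eq minus_divide_divide)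
          then show ?thesis using bound[of y x] y True by (auto simp: field_simps)
        next
          case False
          then show ?thesis using bound[of x y] y by (auto simp: field_simps)
        qed
        then show "norm ((g y - g x) / (y - x) - D) < r" using e by auto
      qed
    qed
    then show ?thesis by (auto simp: real_differentiable_def has_field_derivative_iff)
  qed
  have "AE x in lborel. \<forall>m::nat. \<forall>u\<in>\<rat>. \<forall>v\<in>\<rat>. u < v \<longrightarrow> x \<notin> {x. P v x} \<inter> {x. Q u x} \<inter> {-real m..real m}"
    unfolding AE_all_countable
  proof (intro allI AE_ball_countable'[OF _ countable_rat])
    fix m :: nat and u v :: real
    show "AE x in lborel. u < v \<longrightarrow> x \<notin> {x. P v x} \<inter> {x. Q u x} \<inter> {-real m..real m}"
      using AE_not_in[OF null[of u v "real m"]] by (cases "u < v") auto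
  qed
  then show ?thesis
  proof eventually_elim
    case (elim x)
    obtain m where m: "\<bar>x\<bar> \<le> real m" using real_arch_simple by blast
    show ?case
    proof (rule diff)
      have "x \<in> {-real m..real m}" using m by (simp add: abs_le_iff)
      then show "\<not> (P v x \<and> Q u x)" if "u \<in> \<rat>" "v \<in> \<rat>" "u < v" for u v
        using elim[THEN spec, of m] that by blast
    qed
  qed
qed

text \<open>Adding the linear function \<open>L x\<close> makes \<open>g\<close> monotone, and rescaling makes it 1-Lipschitz; neither
  affects differentiability.\<close>

lemma lipschitz_AE_differentiable:
  fixes g :: "real \<Rightarrow> real"
  assumes lip: "L-lipschitz_on UNIV g"
  shows "AE x in lborel. g differentiable (at x)"
proof -
  \<comment> \<open>the summand 1 keeps the divisor positive when \<open>L = 0\<close>\<close>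
  define c where "c = 2 * L + 1"
  have L: "L \<ge> 0" using lip by (auto simp: lipschitz_on_def)
  have d: "\<bar>g x - g y\<bar> \<le> L * \<bar>x - y\<bar>" for x y using lipschitz_onD[OF lip, of x y] by (auto simp: dist_real_def)
  define h where "h x = (g x + L * x) / c" for x
  have c: "c > 0" "c \<ge> 2 * L" using L by (auto simp: c_def)
  have "AE x in lborel. h differentiable (at x)"
  proof (rule mono_1_lipschitz_AE_differentiable)
    fix x y :: real assume xy: "x \<le> y"
    then have *: "\<bar>g x - g y\<bar> \<le> L * (y - x)" using d[of x y] by auto
    then have "g x + L * x \<le> g y + L * y" by (auto simp: abs_le_iff algebra_simps)
    then show "h x \<le> h y" unfolding h_def using c by (intro divide_right_mono) auto
    have "(g y + L * y) - (g x + L * x) \<le> 2 * L * (y - x)" using * by (auto simp: abs_le_iff algebra_simps)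
    also have "\<dots> \<le> c * (y - x)" using c xy by (intro mult_right_mono) auto
    finally show "h y - h x \<le> y - x" unfolding h_def using c 
      by (simp add: diff_divide_distrib[symmetric] pos_divide_le_eq mult.commute)
  qed
  then show ?thesis
  proof eventually_elim
    case (elim x)
    have "(\<lambda>x. c * h x - L * x) differentiable (at x)" using elim by (intro derivative_intros) 
    moreover have "(\<lambda>x. c * h x - L * x) = g" using c by (auto simp: h_def)
    ultimately show ?case by simp
  qed
qed

text \<open>Difference quotients over intervals that shrink to \<open>s\<close> and contain it, possibly as an endpoint.
  This is the form in which derivatives arise from partitions.\<close>

lemma DERIV_straddle:
  fixes g :: "real \<Rightarrow> real"
  assumes d: "(g has_real_derivative d) (at s)"
    and ab: "\<And>n. a n \<le> s" "\<And>n. s \<le> b n" "\<And>n. a n < b n"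
    and lim: "a \<longlonglongrightarrow> s" "b \<longlonglongrightarrow> s"
  shows "(\<lambda>n. (g (b n) - g (a n)) / (b n - a n)) \<longlonglongrightarrow> d"
proof (rule LIMSEQ_I)
  fix r :: real assume r: "0 < r"
  have "(g has_derivative (\<lambda>y. d * y)) (at s)" using d by (simp add: has_field_derivative_def)
  then obtain \<delta> where \<delta>: "0 < \<delta>" "\<And>y. \<bar>y - s\<bar> < \<delta> \<Longrightarrow> \<bar>g y - g s - d * (y - s)\<bar> \<le> r/2 * \<bar>y - s\<bar>"
    unfolding has_derivative_at_alt using r by (metis half_gt_zero real_norm_def)
  have "\<forall>\<^sub>F n in sequentially. s - \<delta> < a n" "\<forall>\<^sub>F n in sequentially. b n < s + \<delta>"
    using lim \<delta>(1) by (auto intro: order_tendstoD)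
  then have "\<forall>\<^sub>F n in sequentially. norm ((g (b n) - g (a n)) / (b n - a n) - d) < r"
  proof eventually_elim
    case (elim n)
    have "\<bar>g (b n) - g s - d * (b n - s)\<bar> \<le> r/2 * (b n - s)" using \<delta>(2)[of "b n"] elim ab[of n] by auto
    moreover have "\<bar>g (a n) - g s - d * (a n - s)\<bar> \<le> r/2 * (s - a n)" using \<delta>(2)[of "a n"] elim ab[of n] by auto
    ultimately have "\<bar>(g (b n) - g s - d * (b n - s)) - (g (a n) - g s - d * (a n - s))\<bar> \<le> r/2 * (b n - s) + r/2 * (s - a n)"
      by linarith
    moreover have "r/2 * (b n - s) + r/2 * (s - a n) = r/2 * (b n - a n)"
      by (simp only: distrib_left[symmetric]) simp
    moreover have "(g (b n) - g s - d * (b n - s)) - (g (a n) - g s - d * (a n - s)) = (g (b n) - g (a n)) - d * (b n - a n)"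
      by (simp add: algebra_simps)
    ultimately have "\<bar>(g (b n) - g (a n)) - d * (b n - a n)\<bar> \<le> r/2 * (b n - a n)" by simp
    moreover have "(g (b n) - g (a n)) / (b n - a n) - d = ((g (b n) - g (a n)) - d * (b n - a n)) / (b n - a n)"
      using ab(3)[of n] by (simp add: field_simps)
    ultimately have "\<bar>(g (b n) - g (a n)) / (b n - a n) - d\<bar> \<le> r/2"
      using ab(3)[of n] by (simp add: abs_divide pos_divide_le_eq)
    then show ?case using r by simp
  qed
  then show "\<exists>no. \<forall>n\<ge>no. norm ((g (b n) - g (a n)) / (b n - a n) - d) < r"
    by (simp add: eventually_sequentially)
qed

text \<open>The difference quotients with increment \<open>1 / (n + 1)\<close> are bounded by \<open>L\<close>, so their integrals
  converge to the integral of the derivative by dominated convergence; by translation these integrals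
  are differences of averages of \<open>g\<close> near \<open>b\<close> and near \<open>a\<close>.\<close>

lemma lipschitz_FTC:
  fixes g :: "real \<Rightarrow> real"
  assumes lip: "L-lipschitz_on UNIV g"
    and D: "D \<in> borel_measurable borel" "AE x in lborel. (g has_real_derivative D x) (at x)"
    and ab: "a \<le> b"
  shows "set_integrable lborel {a..b} D" "(LINT x:{a..b}|lborel. D x) = g b - g a"
proof -
  have L: "L \<ge> 0" using lip by (auto simp: lipschitz_on_def)
  have d: "\<bar>g x - g y\<bar> \<le> L * \<bar>x - y\<bar>" for x y using lipschitz_onD[OF lip, of x y] by (auto simp: dist_real_def)
  have cont: "continuous_on A g" for A
    using lipschitz_on_continuous_on[OF lip] continuous_on_subset by blast
  have gm: "g \<in> borel_measurable borel" using cont[of UNIV] by (rule borel_measurable_continuous_onI)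
  define h where "h n = 1 / real (Suc n)" for n
  have h: "h n > 0" for n by (simp add: h_def)
  have hnz: "h n \<noteq> 0" for n by (simp add: h_def)
  have hlim: "h \<longlonglongrightarrow> 0" unfolding h_def using LIMSEQ_inverse_real_of_nat by (simp add: inverse_eq_divide)
  define q where "q n x = (g (x + h n) - g x) / h n" for n x
  have qb: "\<bar>q n x\<bar> \<le> L" for n x
    using d[of "x + h n" x] h[of n] by (simp add: q_def abs_divide divide_le_eq mult.commute)
  have lim: "AE x in lborel. (\<lambda>n. indicator {a..b} x * q n x) \<longlonglongrightarrow> indicator {a..b} x * D x"
    using D(2)
  proof eventually_elim
    case (elim x)
    have "filterlim h (at 0) sequentially"
      using hlim hnz by (simp add: filterlim_at)
    moreover have "((\<lambda>t. (g (x + t) - g x) / t) \<longlongrightarrow> D x) (at 0)"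
      using elim by (simp add: DERIV_def)
    ultimately have "(\<lambda>n. q n x) \<longlonglongrightarrow> D x"
      unfolding q_def by (rule filterlim_compose[rotated])
    then show ?case by (intro tendsto_intros)
  qed
  have w: "integrable lborel (\<lambda>x. indicator {a..b} x * L)"
    using ab by (intro integrable_mult_left integrable_real_indicator) auto
  have bd: "norm (indicator {a..b} x * q n x) \<le> indicator {a..b} x * L" for n x
    using qb by (auto simp: indicator_def)
  have m1: "(\<lambda>x. indicator {a..b} x * D x) \<in> borel_measurable lborel"
    using D(1) by (intro borel_measurable_times) auto
  have m2: "(\<lambda>x. indicator {a..b} x * q n x) \<in> borel_measurable lborel" for n
    unfolding q_def using gm by (intro borel_measurable_times borel_measurable_divide borel_measurable_diff) auto
  have bdAE: "AE x in lborel. norm (indicator {a..b} x * q n x) \<le> indicator {a..b} x * L" for n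
    by (rule AE_I2[OF bd])
  show "set_integrable lborel {a..b} D"
    using integrable_dominated_convergence[OF m1 m2 w lim bdAE] by (simp add: set_integrable_def)
  have int: "g integrable_on {x..y}" for x y by (rule integrable_continuous_interval[OF cont])
  have qi: "(\<integral>x. indicator {a..b} x * q n x \<partial>lborel)
      = (integral {b..b + h n} g - integral {a..a + h n} g) / h n" for n
  proof -
    have c: "continuous_on {a..b} (\<lambda>x. g (x + h n))"
      by (intro continuous_on_compose2[OF cont[of UNIV]] continuous_intros) auto
    have cq: "continuous_on {a..b} (q n)" unfolding q_def using h[of n]
      by (intro continuous_intros c cont) auto
    have "(\<integral>x. indicator {a..b} x * q n x \<partial>lborel) = (LINT x:{a..b}|lborel. q n x)"
      by (simp add: set_lebesgue_integral_def)
    also have "\<dots> = integral {a..b} (q n)"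
      by (intro set_borel_integral_eq_integral borel_integrable_atLeastAtMost' cq)
    also have "\<dots> = (integral {a..b} (\<lambda>x. g (x + h n)) - integral {a..b} g) / h n"
      unfolding q_def by (simp add: integral_diff integrable_continuous_interval c int)
    also have "integral {a..b} (\<lambda>x. g (x + h n)) = integral {a + h n..b + h n} g"
      using integral_shift_Icc_real[of a b g "h n"] by (simp add: o_def add.commute)
    also have "integral {a + h n..b + h n} g - integral {a..b} g = integral {b..b + h n} g - integral {a..a + h n} g"
    proof -
      have "integral {a..b} g + integral {b..b + h n} g = integral {a..b + h n} g"
        by (rule Henstock_Kurzweil_Integration.integral_combine) (use h[of n] ab int in auto)
      moreover have "integral {a..a + h n} g + integral {a + h n..b + h n} g = integral {a..b + h n} g"
        by (rule Henstock_Kurzweil_Integration.integral_combine) (use h[of n] ab int in auto)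
      ultimately show ?thesis by simp
    qed
    finally show ?thesis .
  qed
  have avg: "(\<lambda>n. integral {x..x + h n} g / h n) \<longlonglongrightarrow> g x" for x
  proof -
    have "\<bar>integral {x..x + h n} g / h n - g x\<bar> \<le> L * h n" for n
    proof -
      have "\<bar>integral {x..x + h n} g - g x * h n\<bar> = \<bar>integral {x..x + h n} (\<lambda>y. g y - g x)\<bar>"
      proof -
        have "integral {x..x + h n} (\<lambda>y. g y - g x) = integral {x..x + h n} g - integral {x..x + h n} (\<lambda>_. g x)"
          by (rule integral_diff) (auto intro: int)
        then show ?thesis using h[of n] by (simp add: mult.commute)
      qed
      also have "\<dots> \<le> (L * h n) * (x + h n - x)"
      proof -
        have "norm (integral {x..x + h n} (\<lambda>y. g y - g x)) \<le> (L * h n) * (x + h n - x)"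
        proof (rule integral_bound)
          show "norm (g y - g x) \<le> L * h n" if "y \<in> {x..x + h n}" for y
            using order_trans[OF d mult_left_mono[OF _ L], of y x "h n"] that by auto
        qed (use h[of n] in \<open>auto intro!: continuous_intros cont\<close>)
        then show ?thesis by simp
      qed
      finally show ?thesis using h[of n]
        by (simp add: abs_le_iff field_simps)
    qed
    then have "(\<lambda>n. integral {x..x + h n} g / h n - g x) \<longlonglongrightarrow> 0"
      by (intro Lim_null_comparison[OF _ tendsto_mult_right_zero[OF hlim, of L]]) simp
    then show ?thesis by (simp add: LIM_zero_iff)
  qed
  have "(\<lambda>n. \<integral>x. indicator {a..b} x * q n x \<partial>lborel) \<longlonglongrightarrow> g b - g a"
    unfolding qi diff_divide_distrib by (intro tendsto_diff avg)
  with integral_dominated_convergence[OF m1 m2 w lim bdAE] have "(\<integral>x. indicator {a..b} x * D x \<partial>lborel) = g b - g a"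
    by (rule LIMSEQ_unique)
  then show "(LINT x:{a..b}|lborel. D x) = g b - g a"
    by (simp add: set_lebesgue_integral_def)
qed

section \<open>The modulus of the gradient and the coarea inequality\<close>

text \<open>The supremum over all of \<open>ball x h\<close> has the same value as over the punctured ball, because the
  centre contributes \<open>0 / 0 = 0\<close>; including the centre keeps the index set nonempty.\<close>

definition max_slope :: "('a::metric_space \<Rightarrow> real) \<Rightarrow> real \<Rightarrow> 'a \<Rightarrow> real" where
  "max_slope f h x = (SUP y\<in>ball x h. \<bar>f x - f y\<bar> / dist x y)"

lemma lipschitz_abs_diff_le:
  fixes f :: "'a::metric_space \<Rightarrow> real"
  assumes "L-lipschitz_on UNIV f"
  shows "\<bar>f x - f y\<bar> \<le> L * dist x y"
  using lipschitz_onD[OF assms, of x y] by (simp add: dist_real_def)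

lemma slope_le:
  fixes f :: "'a::metric_space \<Rightarrow> real"
  assumes "L-lipschitz_on UNIV f"
  shows "\<bar>f x - f y\<bar> / dist x y \<le> L"
proof (cases "x = y")
  case True then show ?thesis using lipschitz_on_nonneg[OF assms] by simp
next
  case False then show ?thesis using lipschitz_abs_diff_le[OF assms, of x y] by (simp add: divide_le_eq)
qed

lemma bdd_above_slope:
  fixes f :: "'a::metric_space \<Rightarrow> real"
  assumes "L-lipschitz_on UNIV f"
  shows "bdd_above ((\<lambda>y. \<bar>f x - f y\<bar> / dist x y) ` S)"
  using slope_le[OF assms] by (auto intro!: bdd_aboveI[of _ L])

lemma slope_le_max_slope:
  assumes "L-lipschitz_on UNIV f" "dist x y < h"
  shows "\<bar>f x - f y\<bar> / dist x y \<le> max_slope f h x"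
  unfolding max_slope_def by (rule cSUP_upper) (use assms bdd_above_slope in auto)

lemma max_slope_le:
  assumes "L-lipschitz_on UNIV f" "0 < h"
  shows "max_slope f h x \<le> L"
  unfolding max_slope_def by (rule cSUP_least) (use assms slope_le in auto)

lemma max_slope_nonneg:
  assumes "L-lipschitz_on UNIV f" "0 < h"
  shows "0 \<le> max_slope f h x"
  using slope_le_max_slope[OF assms(1), of x x h] assms(2) by simp

lemma max_slope_mono:
  assumes "L-lipschitz_on UNIV f" "0 < h" "h \<le> k"
  shows "max_slope f h x \<le> max_slope f k x"
  unfolding max_slope_def
  by (rule cSUP_subset_mono) (use assms bdd_above_slope in auto)

text \<open>The maximal slope at a fixed scale is lower semicontinuous, as a supremum of slopes to points
  \<open>y\<close>, each of which can be kept fixed while \<open>x\<close> moves a little.\<close>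

lemma open_max_slope_greater:
  fixes f :: "'a::metric_space \<Rightarrow> real"
  assumes "L-lipschitz_on UNIV f" "0 < h" "0 \<le> c"
  shows "open {x. c < max_slope f h x}"
proof -
  have cont: "continuous_on UNIV f" using lipschitz_on_continuous_on[OF assms(1)] .
  have "c < \<bar>f x - f y\<bar> / dist x y \<longleftrightarrow> c * dist x y < \<bar>f x - f y\<bar>" for x y
    using assms(3) by (cases "x = y") (auto simp: less_divide_eq)
  then have "{x. c < max_slope f h x} = (\<Union>y. {x. dist x y < h} \<inter> {x. c * dist x y < \<bar>f x - f y\<bar>})"
    unfolding max_slope_def using assms(2)
    by (subst less_cSUP_iff) (auto intro: bdd_above_slope[OF assms(1)])
  then show ?thesis
    by (auto intro!: open_Int open_Collect_less continuous_intros cont)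
qed

lemma borel_measurable_max_slope:
  assumes "L-lipschitz_on UNIV f" "0 < h"
  shows "max_slope f h \<in> borel_measurable borel"
proof (rule borel_measurableI_greater)
  fix c
  show "{x \<in> space borel. c < max_slope f h x} \<in> sets borel"
  proof (cases "0 \<le> c")
    case True then show ?thesis using open_max_slope_greater[OF assms True] by simp
  next
    case False
    then have "{x \<in> space borel. c < max_slope f h x} = UNIV"
      using max_slope_nonneg[OF assms] by (auto intro: less_le_trans[of c 0])
    then show ?thesis by simp
  qed
qed

text \<open>This exhibits the upper limit that defines \<open>grad_norm\<close> as a decreasing limit of bounded Borel
  functions.  At an isolated point both sides are \<open>0\<close>.\<close>

lemma max_slope_tendsto_grad_norm:
  fixes f :: "'a::metric_space \<Rightarrow> real"
  assumes lip: "L-lipschitz_on UNIV f"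
  shows "(\<lambda>n. max_slope f (1 / real (Suc n)) x) \<longlonglongrightarrow> grad_norm f x"
proof (cases "at x = bot")
  case True
  then have "open {x}" by (simp add: at_eq_bot_iff)
  then obtain e where e: "e > 0" "ball x e \<subseteq> {x}" by (meson openE insertI1)
  have 1: "max_slope f h x = 0" if "0 < h" "h \<le> e" for h
  proof -
    have "ball x h = {x}" using that e by (auto simp: subset_iff)
    then show ?thesis by (simp add: max_slope_def)
  qed
  obtain N where N: "1 / real (Suc N) < e" using e nat_approx_posE by blast
  have "max_slope f (1 / real (Suc n)) x = 0" if "n \<ge> N" for n
  proof (rule 1)
    have "1 / real (Suc n) \<le> 1 / real (Suc N)" using that by (intro divide_left_mono) auto
    then show "1 / real (Suc n) \<le> e" using N by simp
  qed simp
  then have "\<forall>\<^sub>F n in sequentially. max_slope f (1 / real (Suc n)) x = 0"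
    unfolding eventually_sequentially by blast
  moreover have "grad_norm f x = 0" unfolding grad_norm_def True Limsup_bot by (simp add: bot_ereal_def)
  ultimately show ?thesis by (simp add: tendsto_eventually)
next
  case False
  define Q where "Q y = \<bar>f x - f y\<bar> / dist x y" for y
  have ne: "ball x h - {x} \<noteq> {}" if "0 < h" for h
  proof
    assume "ball x h - {x} = {}"
    then have "ball x h = {x}" using that by auto
    then have "open {x}" by (metis open_ball)
    with False show False by (simp add: at_eq_bot_iff)
  qed
  have eq: "ereal (max_slope f h x) = (SUP y\<in>ball x h - {x}. ereal (Q y))" if h: "0 < h" for h
  proof -
    have ins: "ball x h = insert x (ball x h - {x})" using h by auto
    have up: "(SUP y\<in>ball x h. ereal (Q y)) \<le> ereal L"
      by (rule SUP_least) (auto simp: Q_def slope_le[OF lip])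
    moreover have "ereal (Q x) \<le> (SUP y\<in>ball x h. ereal (Q y))" using h by (intro SUP_upper) auto
    ultimately have "\<bar>SUP y\<in>ball x h. ereal (Q y)\<bar> \<noteq> \<infinity>" by auto
    then have "ereal (max_slope f h x) = (SUP y\<in>ball x h. ereal (Q y))"
      unfolding max_slope_def Q_def[symmetric] by (rule ereal_SUP)
    also have "\<dots> = sup (ereal (Q x)) (SUP y\<in>ball x h - {x}. ereal (Q y))"
      by (subst ins) (rule SUP_insert)
    also have "\<dots> = (SUP y\<in>ball x h - {x}. ereal (Q y))"
    proof (rule sup_absorb2)
      obtain y where "y \<in> ball x h - {x}" using ne[OF h] by (metis ex_in_conv)
      then show "ereal (Q x) \<le> (SUP y\<in>ball x h - {x}. ereal (Q y))"
        by (rule SUP_upper2) (simp add: Q_def)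
    qed
    finally show ?thesis .
  qed
  define X where "X n = ereal (max_slope f (1 / real (Suc n)) x)" for n
  define l where "l = Limsup (at x) (\<lambda>y. ereal (Q y))"
  have l: "l = (INF e\<in>{0<..}. ereal (max_slope f e x))"
    unfolding l_def Limsup_at using eq by (auto intro!: INF_cong)
  have "decseq X" unfolding X_def decseq_def
    by (auto intro!: max_slope_mono[OF lip] simp: field_simps)
  then have "X \<longlonglongrightarrow> (INF n. X n)" by (rule LIMSEQ_INF)
  moreover have "(INF n. X n) = l"
  proof (rule antisym)
    show "l \<le> (INF n. X n)" unfolding l X_def
      by (rule INF_mono) (metis greaterThan_iff of_nat_0_less_iff order_refl zero_less_Suc zero_less_divide_1_iff)
    show "(INF n. X n) \<le> l" unfolding l
    proof (rule INF_mono)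
      fix e :: real assume "e \<in> {0<..}"
      then obtain n where n: "1 / real (Suc n) < e" using nat_approx_posE by (metis greaterThan_iff)
      then have "X n \<le> ereal (max_slope f e x)" unfolding X_def
        by (auto intro!: max_slope_mono[OF lip])
      then show "\<exists>n\<in>UNIV. X n \<le> ereal (max_slope f e x)" by blast
    qed
  qed
  ultimately have Xl: "X \<longlonglongrightarrow> l" by simp
  have "0 \<le> l" by (rule tendsto_lowerbound[OF Xl]) (auto simp: X_def max_slope_nonneg[OF lip])
  moreover have "l \<le> ereal L" by (rule tendsto_upperbound[OF Xl]) (auto simp: X_def max_slope_le[OF lip])
  ultimately obtain r where r: "l = ereal r" by (cases l) auto
  have "(\<lambda>n. real_of_ereal (X n)) \<longlonglongrightarrow> r"
    by (rule lim_real_of_ereal) (use Xl r in simp)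
  moreover have "grad_norm f x = r" using r by (simp add: grad_norm_def l_def Q_def)
  ultimately show ?thesis by (simp add: X_def)
qed

lemma grad_norm_nonneg:
  assumes "L-lipschitz_on UNIV f" shows "0 \<le> grad_norm f x"
  by (rule tendsto_lowerbound[OF max_slope_tendsto_grad_norm[OF assms]])
    (auto simp: max_slope_nonneg[OF assms])

lemma grad_norm_le:
  assumes "L-lipschitz_on UNIV f" shows "grad_norm f x \<le> L"
  by (rule tendsto_upperbound[OF max_slope_tendsto_grad_norm[OF assms]])
    (auto simp: max_slope_le[OF assms])

lemma borel_measurable_grad_norm:
  assumes "L-lipschitz_on UNIV f" shows "grad_norm f \<in> borel_measurable borel"
  by (rule borel_measurable_LIMSEQ_real[OF max_slope_tendsto_grad_norm[OF assms]])
    (auto intro: borel_measurable_max_slope[OF assms])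

lemma grad_norm_mono:
  assumes f: "L-lipschitz_on UNIV f" and u: "K-lipschitz_on UNIV u"
    and le: "\<And>x y. \<bar>u x - u y\<bar> \<le> \<bar>f x - f y\<bar>"
  shows "grad_norm u x \<le> grad_norm f x"
proof (rule LIMSEQ_le[OF max_slope_tendsto_grad_norm[OF u] max_slope_tendsto_grad_norm[OF f]],
    intro exI allI impI)
  fix n
  show "max_slope u (1 / real (Suc n)) x \<le> max_slope f (1 / real (Suc n)) x"
    unfolding max_slope_def
    by (rule cSUP_mono) (auto intro!: bdd_above_slope[OF f] bexI divide_right_mono le)
qed

text \<open>Let \<open>u\<^sub>h x\<close> be the supremum of \<open>u\<close> over the ball of radius \<open>h\<close> around \<open>x\<close>.  The \<open>h\<close>-neighbourhood of
  a superlevel set \<open>{u > s}\<close> is \<open>{u\<^sub>h > s}\<close>, so integrating its excess measure over all levels \<open>s\<close>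
  gives \<open>\<integral> (u\<^sub>h - u) d\<mu>\<close> by Fubini's theorem.  Here \<open>(u\<^sub>h - u) / h\<close> is at most the maximal slope at scale
  \<open>h\<close>, which decreases to \<open>grad_norm u\<close>.  On the other side, Fatou's lemma brings the Minkowski contents
  of the superlevel sets into the limit \<open>h \<rightarrow> 0\<close>.\<close>

lemma coarea_inequality:
  fixes M :: "'a::metric_space measure" and u :: "'a \<Rightarrow> real"
  assumes fin: "finite_measure M" and sets: "sets M = sets borel"
    and lip: "L-lipschitz_on UNIV u" and J: "isoperimetric_minorant M J"
  shows "(\<integral>\<^sup>+s. ennreal (J (measure M {x. s < u x})) \<partial>lborel) \<le> (\<integral>\<^sup>+x. ennreal (grad_norm u x) \<partial>M)"
proof -
  interpret finite_measure M by (rule fin)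
  note [measurable_cong] = sets
  have spM: "space M = UNIV" using sets_eq_imp_space_eq[OF sets] by simp
  have cont: "continuous_on UNIV u" using lipschitz_on_continuous_on[OF lip] .
  have um[measurable]: "u \<in> borel_measurable borel" using cont by (rule borel_measurable_continuous_onI)
  define h where "h n = 1 / real (Suc n)" for n
  have h: "h n > 0" for n by (simp add: h_def)
  have hnz: "h n \<noteq> 0" for n by (simp add: h_def)
  have hlim: "h \<longlonglongrightarrow> 0" unfolding h_def using LIMSEQ_inverse_real_of_nat by (simp add: inverse_eq_divide)
  define U where "U n x = (SUP y\<in>ball x (h n). u y)" for n x
  have bound: "u y \<le> u x + max_slope u (h n) x * h n" if "dist x y < h n" for x y n
  proof -
    have "\<bar>u x - u y\<bar> \<le> max_slope u (h n) x * dist x y"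
      using slope_le_max_slope[OF lip that] by (cases "x = y") (auto simp: divide_le_eq)
    also have "\<dots> \<le> max_slope u (h n) x * h n"
      using that max_slope_nonneg[OF lip h] by (intro mult_left_mono) auto
    finally show ?thesis by simp
  qed
  have bdd: "bdd_above (u ` ball x (h n))" for x n
    using bound by (intro bdd_aboveI[of _ "u x + max_slope u (h n) x * h n"]) auto
  have U1: "u x \<le> U n x" for n x unfolding U_def by (rule cSUP_upper) (use h[of n] bdd in auto)
  have U2: "U n x - u x \<le> max_slope u (h n) x * h n" for n x
  proof -
    have "U n x \<le> u x + max_slope u (h n) x * h n"
      unfolding U_def by (rule cSUP_least) (use h[of n] bound in auto)
    then show ?thesis by simp
  qed
  have U3: "s < U n x \<longleftrightarrow> (\<exists>y. dist x y < h n \<and> s < u y)" for s n x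
    unfolding U_def using h[of n] by (subst less_cSUP_iff) (auto simp: bdd)
  have nb: "nbhd {x. s < u x} (h n) = {x. s < U n x}" for s n
    unfolding nbhd_def U3 INF_less_iff by auto
  have Um[measurable]: "U n \<in> borel_measurable borel" for n
  proof (rule borel_measurableI_greater)
    fix c
    have "{x. c < U n x} = (\<Union>y\<in>{y. c < u y}. ball y (h n))" unfolding U3 by (auto simp: dist_commute)
    then have "open {x. c < U n x}" by auto
    then show "{x \<in> space borel. c < U n x} \<in> sets borel" by simp
  qed
  define R where "R n s = ennreal ((measure M (nbhd {x. s < u x} (h n)) - measure M {x. s < u x}) / h n)" for n s
  have diff: "R n s = (\<integral>\<^sup>+x. (if u x \<le> s \<and> s < U n x then 1 else 0) \<partial>M) * ennreal (1 / h n)" for n s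
  proof -
    have "measure M {x. s < U n x} - measure M {x. s < u x} = measure M ({x. s < U n x} - {x. s < u x})"
    proof (rule finite_measure_Diff[symmetric])
      show "{x. s < U n x} \<in> sets M" "{x. s < u x} \<in> sets M"
        unfolding sets by measurable
      show "{x. s < u x} \<subseteq> {x. s < U n x}" using U1 by (auto intro: less_le_trans)
    qed
    also have "{x. s < U n x} - {x. s < u x} = {x. u x \<le> s \<and> s < U n x}" by auto
    finally have "R n s = ennreal (measure M {x. u x \<le> s \<and> s < U n x}) * ennreal (1 / h n)"
      unfolding R_def nb using h[of n] by (simp add: ennreal_mult[symmetric] less_imp_le)
    also have "ennreal (measure M {x. u x \<le> s \<and> s < U n x}) = (\<integral>\<^sup>+x. indicator {x. u x \<le> s \<and> s < U n x} x \<partial>M)"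
      by (subst nn_integral_indicator) (auto simp: emeasure_eq_measure sets)
    also have "\<dots> = (\<integral>\<^sup>+x. (if u x \<le> s \<and> s < U n x then 1 else 0) \<partial>M)"
      by (intro nn_integral_cong) (auto simp: indicator_def)
    finally show ?thesis .
  qed
  have Rm: "R n \<in> borel_measurable lborel" for n unfolding diff by measurable
  have Rint: "(\<integral>\<^sup>+s. R n s \<partial>lborel) \<le> (\<integral>\<^sup>+x. ennreal (max_slope u (h n) x) \<partial>M)" for n
  proof -
    interpret P: pair_sigma_finite M lborel ..
    have "(\<integral>\<^sup>+s. R n s \<partial>lborel) = (\<integral>\<^sup>+s. (\<integral>\<^sup>+x. (if u x \<le> s \<and> s < U n x then 1 else 0) \<partial>M) \<partial>lborel) * ennreal (1 / h n)"
      unfolding diff by (rule nn_integral_multc) measurable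
    also have "(\<integral>\<^sup>+s. (\<integral>\<^sup>+x. (if u x \<le> s \<and> s < U n x then 1 else 0) \<partial>M) \<partial>lborel) =
      (\<integral>\<^sup>+x. (\<integral>\<^sup>+s. (if u x \<le> s \<and> s < U n x then 1 else 0) \<partial>lborel) \<partial>M)"
      by (rule P.Fubini') measurable
    also have "\<dots> = (\<integral>\<^sup>+x. ennreal (U n x - u x) \<partial>M)"
    proof (rule nn_integral_cong)
      fix x
      have "(\<integral>\<^sup>+s. (if u x \<le> s \<and> s < U n x then 1 else 0) \<partial>lborel) = (\<integral>\<^sup>+s. indicator {u x..<U n x} s \<partial>lborel)"
        by (intro nn_integral_cong) (auto simp: indicator_def)
      then show "(\<integral>\<^sup>+s. (if u x \<le> s \<and> s < U n x then 1 else 0) \<partial>lborel) = ennreal (U n x - u x)"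
        using U1[of x n] by simp
    qed
    also have "\<dots> * ennreal (1 / h n) = (\<integral>\<^sup>+x. ennreal (U n x - u x) * ennreal (1 / h n) \<partial>M)"
      by (rule nn_integral_multc[symmetric]) measurable
    also have "\<dots> \<le> (\<integral>\<^sup>+x. ennreal (max_slope u (h n) x) \<partial>M)"
    proof (rule nn_integral_mono)
      fix x
      have "(U n x - u x) * (1 / h n) \<le> max_slope u (h n) x" 
        using U2[of n x] h[of n] by (simp add: divide_le_eq)
      then show "ennreal (U n x - u x) * ennreal (1 / h n) \<le> ennreal (max_slope u (h n) x)"
        using U1[of x n] h[of n] by (simp add: ennreal_mult[symmetric] ennreal_leI less_imp_le)
    qed
    finally show ?thesis .
  qed
  have Jle: "ennreal (J (measure M {x. s < u x})) \<le> liminf (\<lambda>n. R n s)" for s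
    unfolding le_Liminf_iff
  proof (intro allI impI)
    fix y assume y: "y < ennreal (J (measure M {x. s < u x}))"
    then obtain r where r: "y = ennreal r" "0 \<le> r" by (cases y) auto
    have "r < J (measure M {x. s < u x})" using y r by (simp add: ennreal_less_iff)
    moreover have "{x. s < u x} \<in> sets borel" by measurable
    then have "ereal (J (measure M {x. s < u x})) \<le> minkowski_content M {x. s < u x}"
      using J by (auto simp: isoperimetric_minorant_def)
    ultimately have "ereal r < minkowski_content M {x. s < u x}" by (meson ereal_less(2) less_ereal.simps(1) less_le_trans)
    then have "\<forall>\<^sub>F k in at_right 0. ereal r < ereal ((measure M (nbhd {x. s < u x} k) - measure M {x. s < u x}) / k)"
      unfolding minkowski_content_def by (rule less_LiminfD)
    moreover have "filterlim h (at_right 0) sequentially"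
      using hlim h hnz by (simp add: filterlim_at)
    ultimately have "\<forall>\<^sub>F n in sequentially. ereal r < ereal ((measure M (nbhd {x. s < u x} (h n)) - measure M {x. s < u x}) / h n)"
      unfolding filterlim_iff by blast
    then show "\<forall>\<^sub>F n in sequentially. y < R n s"
    proof eventually_elim
      case (elim n)
      then show ?case unfolding R_def r(1) using r(2) by (intro ennreal_lessI) auto
    qed
  qed
  have "(\<integral>\<^sup>+s. ennreal (J (measure M {x. s < u x})) \<partial>lborel) \<le> (\<integral>\<^sup>+s. liminf (\<lambda>n. R n s) \<partial>lborel)"
    by (intro nn_integral_mono Jle)
  also have "\<dots> \<le> liminf (\<lambda>n. \<integral>\<^sup>+s. R n s \<partial>lborel)"
    by (rule nn_integral_liminf) (rule Rm)
  also have "\<dots> \<le> liminf (\<lambda>n. \<integral>\<^sup>+x. ennreal (max_slope u (h n) x) \<partial>M)"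
    by (rule Liminf_mono) (auto simp: Rint)
  also have "\<dots> = (\<integral>\<^sup>+x. ennreal (grad_norm u x) \<partial>M)"
  proof (rule lim_imp_Liminf)
    show "(\<lambda>n. \<integral>\<^sup>+x. ennreal (max_slope u (h n) x) \<partial>M) \<longlonglongrightarrow> (\<integral>\<^sup>+x. ennreal (grad_norm u x) \<partial>M)"
    proof (rule nn_integral_dominated_convergence[where w = "\<lambda>_. ennreal L"])
      show "(\<lambda>x. ennreal (max_slope u (h n) x)) \<in> borel_measurable M" for n
        using borel_measurable_max_slope[OF lip h, of n] by measurable
      show "(\<lambda>x. ennreal (grad_norm u x)) \<in> borel_measurable M"
        using borel_measurable_grad_norm[OF lip] by measurable
      show "(\<integral>\<^sup>+x. ennreal L \<partial>M) < \<infinity>" 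
        by (simp add: emeasure_eq_measure ennreal_mult_less_top)
      show "AE x in M. (\<lambda>n. ennreal (max_slope u (h n) x)) \<longlonglongrightarrow> ennreal (grad_norm u x)"
        unfolding h_def by (intro AE_I2 tendsto_ennrealI max_slope_tendsto_grad_norm[OF lip])
      show "AE x in M. ennreal (max_slope u (h n) x) \<le> ennreal L" for n
        by (intro AE_I2 ennreal_leI max_slope_le[OF lip h])
    qed auto
  qed auto
  finally show ?thesis .
qed

section \<open>Decreasing rearrangements\<close>

context
  fixes N :: "'b measure" and u :: "'b \<Rightarrow> real"
  assumes fin: "finite_measure N" and u[measurable]: "u \<in> borel_measurable N"
begin

lemma distr_fun_antimono: "c \<le> d \<Longrightarrow> distr_fun N u d \<le> distr_fun N u c"
  unfolding distr_fun_def
  by (intro finite_measure.finite_measure_mono[OF fin]) auto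

text \<open>Right continuity of the antimonotone distribution function, stated as closedness of the set
  over which \<open>rearr\<close> takes its infimum.\<close>

lemma distr_fun_right_continuous:
  assumes "\<And>d. c < d \<Longrightarrow> distr_fun N u d \<le> s"
  shows "distr_fun N u c \<le> s"
proof -
  interpret finite_measure N by (rule fin)
  define A where "A n = {x \<in> space N. c + 1 / real (Suc n) < \<bar>u x\<bar>}" for n
  have "incseq A" unfolding incseq_def
  proof safe
    fix m n x assume mn: "m \<le> n" and x: "x \<in> A m"
    have "1 / real (Suc n) \<le> 1 / real (Suc m)" using mn by (intro divide_left_mono) auto
    with x show "x \<in> A n" by (simp add: A_def)
  qed
  moreover have "range A \<subseteq> sets N" unfolding A_def by auto
  ultimately have "(\<lambda>n. measure N (A n)) \<longlonglongrightarrow> measure N (\<Union>n. A n)"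
    by (intro finite_Lim_measure_incseq)
  moreover have "(\<Union>n. A n) = {x \<in> space N. c < \<bar>u x\<bar>}"
  proof safe
    fix x assume x: "x \<in> space N" "c < \<bar>u x\<bar>"
    then obtain n where "1 / real (Suc n) < \<bar>u x\<bar> - c" using nat_approx_posE[of "\<bar>u x\<bar> - c"] by auto
    then show "x \<in> (\<Union>n. A n)" using x by (auto simp: A_def intro!: exI[of _ n])
  next
    fix x n assume "x \<in> A n"
    then show "x \<in> space N" "c < \<bar>u x\<bar>" by (auto simp: A_def intro: le_less_trans[rotated])
  qed
  ultimately have "(\<lambda>n. measure N (A n)) \<longlonglongrightarrow> distr_fun N u c" by (simp add: distr_fun_def)
  then show ?thesis
  proof (rule tendsto_upperbound)
    show "\<forall>\<^sub>F n in sequentially. measure N (A n) \<le> s"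
      using assms[of "c + 1 / real (Suc n)" for n] by (simp add: distr_fun_def A_def)
  qed simp
qed

lemma distr_fun_small:
  assumes "0 < s" shows "\<exists>c\<ge>0. distr_fun N u c \<le> s"
proof -
  interpret finite_measure N by (rule fin)
  define A where "A n = {x \<in> space N. real n < \<bar>u x\<bar>}" for n
  have "decseq A" unfolding A_def decseq_def by (auto intro: le_less_trans[rotated])
  moreover have "range A \<subseteq> sets N" unfolding A_def by auto
  ultimately have "(\<lambda>n. measure N (A n)) \<longlonglongrightarrow> measure N (\<Inter>n. A n)"
    by (intro finite_Lim_measure_decseq)
  moreover have "(\<Inter>n. A n) = {}"
  proof -
    have "\<exists>n. \<not> real n < \<bar>u x\<bar>" for x
      using real_arch_simple[of "\<bar>u x\<bar>"] by (simp add: not_less)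
    then show ?thesis unfolding A_def by blast
  qed
  ultimately have "(\<lambda>n. measure N (A n)) \<longlonglongrightarrow> 0" by simp
  then obtain n where "measure N (A n) < s" using assms
    by (metis eventually_sequentially order_refl order_tendstoD(2))
  then show ?thesis unfolding distr_fun_def A_def
    by (intro exI[of _ "real n"]) auto
qed

text \<open>The Galois connection between a rearrangement and its distribution function.  All properties
  of rearrangements used below follow from it.\<close>

lemma less_rearr_iff:
  assumes "0 < s" "0 \<le> c"
  shows "c < rearr N u s \<longleftrightarrow> s < distr_fun N u c"
proof -
  define S where "S = {c. 0 \<le> c \<and> distr_fun N u c \<le> s}"
  have ne: "S \<noteq> {}" using distr_fun_small[OF assms(1)] by (auto simp: S_def)
  have bdd: "bdd_below S" by (auto simp: S_def intro: bdd_belowI[of _ 0])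
  have "rearr N u s \<le> c \<longleftrightarrow> distr_fun N u c \<le> s"
  proof
    assume "distr_fun N u c \<le> s"
    then show "rearr N u s \<le> c" unfolding rearr_def S_def[symmetric]
      using assms by (intro cInf_lower bdd) (auto simp: S_def)
  next
    assume le: "rearr N u s \<le> c"
    show "distr_fun N u c \<le> s"
    proof (rule distr_fun_right_continuous)
      fix d assume "c < d"
      then have "Inf S < d" using le by (simp add: rearr_def S_def)
      then obtain e where "e \<in> S" "e < d" using cInf_lessD[OF ne] by auto
      then show "distr_fun N u d \<le> s" using distr_fun_antimono[of e d] by (auto simp: S_def)
    qed
  qed
  then show ?thesis by linarith
qed

lemma rearr_nonneg: "0 < s \<Longrightarrow> 0 \<le> rearr N u s"
  unfolding rearr_def by (rule cInf_greatest) (use distr_fun_small in auto)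

lemma rearr_antimono:
  assumes "0 < s" "s \<le> r" shows "rearr N u r \<le> rearr N u s"
proof (rule ccontr)
  assume "\<not> ?thesis"
  then have "rearr N u s < rearr N u r" by simp
  then have "r < distr_fun N u (rearr N u s)"
    using less_rearr_iff[of r "rearr N u s"] assms rearr_nonneg[of s] by auto
  moreover have "distr_fun N u (rearr N u s) \<le> s"
    using less_rearr_iff[of s "rearr N u s"] assms rearr_nonneg[of s] by auto
  ultimately show False using assms by simp
qed

lemma rearr_le_bound:
  assumes "0 < s" "0 \<le> L" "\<And>x. x \<in> space N \<Longrightarrow> \<bar>u x\<bar> \<le> L"
  shows "rearr N u s \<le> L"
proof -
  have "{x \<in> space N. L < \<bar>u x\<bar>} = {}" using assms(3) by force
  then have "distr_fun N u L = 0" by (simp only: distr_fun_def measure_empty)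
  then show ?thesis using less_rearr_iff[of s L] assms by auto
qed

lemma borel_measurable_rearr:
  "(\<lambda>s. rearr N u s * indicator {0<..<1} s) \<in> borel_measurable borel"
proof (rule borel_measurableI_greater)
  fix c :: real
  have "{s \<in> space borel. c < rearr N u s * indicator {0<..<1} s} =
     (if c < 0 then UNIV else {0<..<min 1 (distr_fun N u c)})"
    using less_rearr_iff[of _ c] rearr_nonneg by (auto simp: indicator_def intro: less_le_trans)
  then show "{s \<in> space borel. c < rearr N u s * indicator {0<..<1} s} \<in> sets borel" by simp
qed

end

lemma rearr_mono:
  assumes "finite_measure N" "u \<in> borel_measurable N" "v \<in> borel_measurable N"
    and "\<And>x. x \<in> space N \<Longrightarrow> \<bar>u x\<bar> \<le> \<bar>v x\<bar>" and s: "0 < s"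
  shows "rearr N u s \<le> rearr N v s"
proof (rule ccontr)
  note [measurable] = assms(2,3)
  define c where "c = rearr N v s"
  have c: "0 \<le> c" unfolding c_def by (rule rearr_nonneg[OF assms(1,3) s])
  assume "\<not> ?thesis"
  then have "s < distr_fun N u c" using less_rearr_iff[OF assms(1,2) s c] by (simp add: c_def)
  also have "\<dots> \<le> distr_fun N v c" unfolding distr_fun_def
    by (intro finite_measure.finite_measure_mono[OF assms(1)]) (auto intro: less_le_trans[OF _ assms(4)])
  finally show False using less_rearr_iff[OF assms(1,3) s c] by (simp add: c_def)
qed

text \<open>A function and its rearrangement are equimeasurable: by \<open>less_rearr_iff\<close> the set
  \<open>{s. c < rearr N u s}\<close> is the interval from \<open>0\<close> to \<open>distr_fun N u c\<close>, so the two image measures agree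
  on the half-lines \<open>{c<..}\<close>.\<close>

lemma nn_integral_rearr:
  assumes N: "prob_space N" and u[measurable]: "u \<in> borel_measurable N"
    and \<phi>[measurable]: "\<phi> \<in> borel_measurable borel"
  shows "(\<integral>\<^sup>+s\<in>{0<..<1}. \<phi> (rearr N u s) \<partial>lborel) = (\<integral>\<^sup>+x. \<phi> \<bar>u x\<bar> \<partial>N)"
proof -
  interpret prob_space N by (rule N)
  note fin = finite_measure_axioms
  define P where "P = restrict_space lborel {0<..<1::real}"
  have spP: "space P = {0<..<1}" by (simp add: P_def space_restrict_space)
  have m[measurable]: "rearr N u \<in> borel_measurable P"
    unfolding P_def using borel_measurable_rearr[OF fin u]
    by (subst borel_measurable_restrict_space_iff) (auto simp: mult.commute)
  have "distr P borel (rearr N u) = distr N borel (\<lambda>x. \<bar>u x\<bar>)"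
  proof (rule measure_eqI_lessThan)
    fix c :: real
    have "emeasure (distr P borel (rearr N u)) {c<..} = emeasure lborel {s. 0 < s \<and> s < 1 \<and> c < rearr N u s}"
    proof -
      have "emeasure (distr P borel (rearr N u)) {c<..} = emeasure P (rearr N u -` {c<..} \<inter> space P)"
        by (rule emeasure_distr[OF m]) simp
      also have "rearr N u -` {c<..} \<inter> space P = {s. 0 < s \<and> s < 1 \<and> c < rearr N u s}"
        by (auto simp: spP)
      also have "emeasure P \<dots> = emeasure lborel \<dots>"
        unfolding P_def by (rule emeasure_restrict_space) auto
      finally show ?thesis .
    qed
    also have "{s. 0 < s \<and> s < 1 \<and> c < rearr N u s} = {0<..<(if c < 0 then 1 else distr_fun N u c)}"
      using less_rearr_iff[OF fin u, of _ c] rearr_nonneg[OF fin u]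
      by (auto simp: distr_fun_def intro: less_le_trans dest: less_le_trans[OF _ prob_le_1])
    also have "emeasure lborel \<dots> = ennreal (if c < 0 then 1 else distr_fun N u c)"
      by (simp add: distr_fun_def)
    also have "\<dots> = emeasure N {x \<in> space N. c < \<bar>u x\<bar>}"
    proof (cases "c < 0")
      case True
      then have "{x \<in> space N. c < \<bar>u x\<bar>} = space N" by (auto intro: less_le_trans)
      then show ?thesis using True by (simp add: emeasure_space_1)
    qed (simp add: distr_fun_def emeasure_eq_measure)
    also have "\<dots> = emeasure (distr N borel (\<lambda>x. \<bar>u x\<bar>)) {c<..}"
      by (subst emeasure_distr) (auto simp: vimage_def Int_def conj_commute)
    finally show "emeasure (distr P borel (rearr N u)) {c<..} = emeasure (distr N borel (\<lambda>x. \<bar>u x\<bar>)) {c<..}" .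
    then show "emeasure (distr P borel (rearr N u)) {c<..} < \<infinity>"
      by (simp add: emeasure_distr emeasure_eq_measure)
  qed simp_all
  then have "(\<integral>\<^sup>+y. \<phi> y \<partial>distr P borel (rearr N u)) = (\<integral>\<^sup>+y. \<phi> y \<partial>distr N borel (\<lambda>x. \<bar>u x\<bar>))" by simp
  then have "(\<integral>\<^sup>+s. \<phi> (rearr N u s) \<partial>P) = (\<integral>\<^sup>+x. \<phi> \<bar>u x\<bar> \<partial>N)"
    by (simp add: nn_integral_distr)
  then show ?thesis by (simp add: P_def nn_integral_restrict_space)
qed

text \<open>Cutting \<open>u\<close> off outside \<open>E\<close> can only decrease the rearrangement and makes it vanish from
  \<open>measure N E\<close> on.\<close>

lemma nn_integral_le_rearr:
  assumes N: "prob_space N" and u[measurable]: "u \<in> borel_measurable N"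
    and \<phi>[measurable]: "\<phi> \<in> borel_measurable borel" and mono: "\<And>x y. 0 \<le> x \<Longrightarrow> x \<le> y \<Longrightarrow> \<phi> x \<le> \<phi> y"
    and \<phi>0: "\<phi> 0 = 0"
    and E[measurable]: "E \<in> sets N" and t: "measure N E \<le> t"
  shows "(\<integral>\<^sup>+x\<in>E. \<phi> \<bar>u x\<bar> \<partial>N) \<le> (\<integral>\<^sup>+s\<in>{0<..<t}. \<phi> (rearr N u s) \<partial>lborel)"
proof -
  interpret prob_space N by (rule N)
  note fin = finite_measure_axioms
  define v where "v x = u x * indicator E x" for x
  have v[measurable]: "v \<in> borel_measurable N" unfolding v_def by measurable
  have "(\<integral>\<^sup>+x\<in>E. \<phi> \<bar>u x\<bar> \<partial>N) = (\<integral>\<^sup>+x. \<phi> \<bar>v x\<bar> \<partial>N)"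
    by (intro nn_integral_cong) (auto simp: v_def indicator_def \<phi>0)
  also have "\<dots> = (\<integral>\<^sup>+s\<in>{0<..<1}. \<phi> (rearr N v s) \<partial>lborel)"
    by (rule nn_integral_rearr[OF N v \<phi>, symmetric])
  also have "\<dots> \<le> (\<integral>\<^sup>+s\<in>{0<..<t}. \<phi> (rearr N u s) \<partial>lborel)"
  proof (rule nn_integral_mono)
    fix s :: real
    show "\<phi> (rearr N v s) * indicator {0<..<1} s \<le> \<phi> (rearr N u s) * indicator {0<..<t} s"
    proof (cases "0 < s \<and> s < 1")
      case True
      then have s: "0 < s" by simp
      show ?thesis
      proof (cases "s < t")
        case True
        have "rearr N v s \<le> rearr N u s"
          by (rule rearr_mono[OF fin v u _ s]) (auto simp: v_def indicator_def)
        then show ?thesis using True s mono[OF rearr_nonneg[OF fin v s]] by (auto simp: indicator_def)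
      next
        case False
        have "distr_fun N v 0 \<le> measure N E" unfolding distr_fun_def
          by (intro finite_measure_mono) (auto simp: v_def indicator_def split: if_splits)
        then have "\<not> 0 < rearr N v s" using less_rearr_iff[OF fin v s, of 0] t False by auto
        then have "rearr N v s = 0" using rearr_nonneg[OF fin v s] by auto
        then show ?thesis by (simp add: \<phi>0)
      qed
    qed (auto simp: indicator_def)
  qed
  finally show ?thesis .
qed

section \<open>The inequalities of Hardy-Littlewood-Polya and Hoelder\<close>

text \<open>Superlevel sets of antimonotone functions are initial segments of \<open>(0,t)\<close>; whether such a
  segment contains its endpoint does not matter for integrals.\<close>

lemma nn_integral_down_closed_eq:
  fixes F :: "real \<Rightarrow> ennreal"
  assumes S: "S \<subseteq> {0<..<t}" "\<And>x y. x \<in> S \<Longrightarrow> 0 < y \<Longrightarrow> y \<le> x \<Longrightarrow> y \<in> S" and ne: "S \<noteq> {}"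
  shows "(\<integral>\<^sup>+s. F s * indicator S s \<partial>lborel) = (\<integral>\<^sup>+s. F s * indicator {0<..<Sup S} s \<partial>lborel)"
proof (rule nn_integral_cong_AE)
  have bdd: "bdd_above S" by (rule bdd_above_mono[OF bdd_above_Ioo S(1)])
  have eq: "indicator S s = (indicator {0<..<Sup S} s :: ennreal)" if "s \<noteq> Sup S" for s
  proof (cases "s \<in> S")
    case True
    then have "s \<le> Sup S" using bdd by (rule cSup_upper)
    with True S(1) that show ?thesis by (auto simp: indicator_def)
  next
    case False
    have "\<not> (0 < s \<and> s < Sup S)"
    proof
      assume *: "0 < s \<and> s < Sup S"
      then obtain x where "x \<in> S" "s < x" using less_cSupD[OF ne] by auto
      with * S(2)[of x s] False show False by auto
    qed
    with False show ?thesis by (auto simp: indicator_def)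
  qed
  show "AE s in lborel. F s * indicator S s = F s * indicator {0<..<Sup S} s"
    using AE_lborel_singleton[of "Sup S"] by eventually_elim (simp add: eq)
qed

text \<open>For \<open>k = B r\<close> the hypothesis becomes \<open>\<integral>\<^sub>0\<^sup>r A \<le> \<integral>\<^sub>0\<^sup>r B\<close>.  By the layer cake formula this extends
  to \<open>\<integral>\<^sub>0\<^sup>t W A \<le> \<integral>\<^sub>0\<^sup>t W B\<close> for every antimonotone weight \<open>W \<ge> 0\<close>.  Choose \<open>W = A\<^bsup>q - 1\<^esup>\<close> and apply Young's
  inequality to \<open>A\<^bsup>q - 1\<^esup> B\<close>: a multiple of \<open>\<integral>\<^sub>0\<^sup>t A\<^sup>q\<close> can then be subtracted, as this integral is
  finite.  Finiteness holds because the hypothesis with \<open>k = L\<close> forces \<open>A \<le> L\<close> almost everywhere.\<close>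

lemma hardy_littlewood_polya_powr:
  fixes A B :: "real \<Rightarrow> real"
  assumes A[measurable]: "A \<in> borel_measurable borel" and B[measurable]: "B \<in> borel_measurable borel"
    and A0: "\<And>s. 0 < s \<Longrightarrow> s < 1 \<Longrightarrow> 0 \<le> A s" and B0: "\<And>s. 0 < s \<Longrightarrow> s < 1 \<Longrightarrow> 0 \<le> B s"
    and Am: "\<And>s r. 0 < s \<Longrightarrow> s \<le> r \<Longrightarrow> r < 1 \<Longrightarrow> A r \<le> A s"
    and Bm: "\<And>s r. 0 < s \<Longrightarrow> s \<le> r \<Longrightarrow> r < 1 \<Longrightarrow> B r \<le> B s"
    and BL: "\<And>s. 0 < s \<Longrightarrow> s < 1 \<Longrightarrow> B s \<le> L"
    and le: "\<And>k. 0 \<le> k \<Longrightarrow> (\<integral>\<^sup>+s\<in>{0<..<1}. ennreal (A s - k) \<partial>lborel) \<le> (\<integral>\<^sup>+s\<in>{0<..<1}. ennreal (B s - k) \<partial>lborel)"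
    and q: "1 \<le> q" and t: "0 < t" "t < 1"
  shows "(\<integral>\<^sup>+s\<in>{0<..<t}. ennreal (A s powr q) \<partial>lborel) \<le> (\<integral>\<^sup>+s\<in>{0<..<t}. ennreal (B s powr q) \<partial>lborel)"
proof -
  have L: "0 \<le> L" using B0[of "1/2"] BL[of "1/2"] by auto
  have step1: "(\<integral>\<^sup>+s. ennreal (A s) * indicator {0<..<r} s \<partial>lborel) \<le> (\<integral>\<^sup>+s. ennreal (B s) * indicator {0<..<r} s \<partial>lborel)"
    if r: "0 < r" "r < 1" for r
  proof -
    \<comment> \<open>beyond \<open>r\<close> the positive part \<open>(B - k)\<^sup>+\<close> vanishes, and before \<open>r\<close> it equals \<open>B - k\<close>\<close>
    define k where "k = B r"
    have k: "0 \<le> k" using B0[OF r] by (simp add: k_def)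
    have "(\<integral>\<^sup>+s. ennreal (A s) * indicator {0<..<r} s \<partial>lborel)
        \<le> (\<integral>\<^sup>+s. ennreal (A s - k) * indicator {0<..<1} s + ennreal k * indicator {0<..<r} s \<partial>lborel)"
    proof (rule nn_integral_mono)
      fix s
      have "ennreal (A s) \<le> ennreal (A s - k) + ennreal k"
        using k by (cases "k \<le> A s") (auto simp: ennreal_plus[symmetric] ennreal_neg ennreal_leI simp del: ennreal_plus)
      then show "ennreal (A s) * indicator {0<..<r} s \<le> ennreal (A s - k) * indicator {0<..<1} s + ennreal k * indicator {0<..<r} s"
        using r by (auto simp: indicator_def)
    qed
    also have "\<dots> = (\<integral>\<^sup>+s. ennreal (A s - k) * indicator {0<..<1} s \<partial>lborel) + (\<integral>\<^sup>+s. ennreal k * indicator {0<..<r} s \<partial>lborel)"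
      by (rule nn_integral_add) measurable
    also have "\<dots> \<le> (\<integral>\<^sup>+s. ennreal (B s - k) * indicator {0<..<1} s \<partial>lborel) + (\<integral>\<^sup>+s. ennreal k * indicator {0<..<r} s \<partial>lborel)"
      by (intro add_right_mono le k)
    also have "\<dots> = (\<integral>\<^sup>+s. ennreal (B s - k) * indicator {0<..<1} s + ennreal k * indicator {0<..<r} s \<partial>lborel)"
      by (rule nn_integral_add[symmetric]) measurable
    also have "\<dots> = (\<integral>\<^sup>+s. ennreal (B s) * indicator {0<..<r} s \<partial>lborel)"
    proof (rule nn_integral_cong)
      fix s
      show "ennreal (B s - k) * indicator {0<..<1} s + ennreal k * indicator {0<..<r} s = ennreal (B s) * indicator {0<..<r} s"
      proof (cases "0 < s \<and> s < 1")
        case True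
        show ?thesis
        proof (cases "s < r")
          case True
          then have "k \<le> B s" using Bm[of s r] r \<open>0 < s \<and> s < 1\<close> by (simp add: k_def)
          then show ?thesis using True k \<open>0 < s \<and> s < 1\<close> by (auto simp: indicator_def ennreal_plus[symmetric] simp del: ennreal_plus)
        next
          case False
          then have "B s \<le> k" using Bm[of r s] r \<open>0 < s \<and> s < 1\<close> by (simp add: k_def)
          then show ?thesis using False by (auto simp: indicator_def ennreal_neg)
        qed
      next
        case False then show ?thesis using r by (auto simp: indicator_def)
      qed
    qed
    finally show ?thesis .
  qed
  have step2: "(\<integral>\<^sup>+s. ennreal (W s) * (ennreal (A s) * indicator {0<..<t} s) \<partial>lborel) \<le> (\<integral>\<^sup>+s. ennreal (W s) * (ennreal (B s) * indicator {0<..<t} s) \<partial>lborel)"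
    if W[measurable]: "W \<in> borel_measurable borel" and W0: "\<And>s. 0 < s \<Longrightarrow> s < t \<Longrightarrow> 0 \<le> W s"
      and Wm: "\<And>s r. 0 < s \<Longrightarrow> s \<le> r \<Longrightarrow> r < t \<Longrightarrow> W r \<le> W s" for W
  proof -
    have lc: "(\<integral>\<^sup>+s. ennreal (W s) * (ennreal (C s) * indicator {0<..<t} s) \<partial>lborel)
        = (\<integral>\<^sup>+l. (\<integral>\<^sup>+s. ennreal (C s) * indicator {s. 0 < s \<and> s < t \<and> l < W s} s \<partial>lborel) * indicator {0..} l \<partial>lborel)"
      if C[measurable]: "C \<in> borel_measurable borel" for C
    proof -
      have "(\<integral>\<^sup>+s. ennreal (W s) * (ennreal (C s) * indicator {0<..<t} s) \<partial>lborel)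
        = (\<integral>\<^sup>+s. (\<integral>\<^sup>+l. ennreal (C s) * (if 0 < s \<and> s < t \<and> 0 \<le> l \<and> l < W s then 1 else 0) \<partial>lborel) \<partial>lborel)"
      proof (rule nn_integral_cong)
        fix s
        have "(\<integral>\<^sup>+l. ennreal (C s) * (if 0 < s \<and> s < t \<and> 0 \<le> l \<and> l < W s then 1 else 0) \<partial>lborel)
          = (\<integral>\<^sup>+l. (ennreal (C s) * indicator {0<..<t} s) * indicator {0..<W s} l \<partial>lborel)"
          by (intro nn_integral_cong) (auto simp: indicator_def)
        also have "\<dots> = (ennreal (C s) * indicator {0<..<t} s) * emeasure lborel {0..<W s}"
          by (rule nn_integral_cmult_indicator) auto
        also have "\<dots> = ennreal (W s) * (ennreal (C s) * indicator {0<..<t} s)"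
          using W0[of s] by (auto simp: indicator_def mult.commute)
        finally show "ennreal (W s) * (ennreal (C s) * indicator {0<..<t} s) = (\<integral>\<^sup>+l. ennreal (C s) * (if 0 < s \<and> s < t \<and> 0 \<le> l \<and> l < W s then 1 else 0) \<partial>lborel)" ..
      qed
      also have "\<dots> = (\<integral>\<^sup>+l. (\<integral>\<^sup>+s. ennreal (C s) * (if 0 < s \<and> s < t \<and> 0 \<le> l \<and> l < W s then 1 else 0) \<partial>lborel) \<partial>lborel)"
        by (rule lborel_pair.Fubini') measurable
      also have "\<dots> = (\<integral>\<^sup>+l. (\<integral>\<^sup>+s. ennreal (C s) * indicator {s. 0 < s \<and> s < t \<and> l < W s} s \<partial>lborel) * indicator {0..} l \<partial>lborel)"
      proof (rule nn_integral_cong)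
        fix l :: real
        show "(\<integral>\<^sup>+s. ennreal (C s) * (if 0 < s \<and> s < t \<and> 0 \<le> l \<and> l < W s then 1 else 0) \<partial>lborel)
          = (\<integral>\<^sup>+s. ennreal (C s) * indicator {s. 0 < s \<and> s < t \<and> l < W s} s \<partial>lborel) * indicator {0..} l"
          by (cases "0 \<le> l") (auto simp: indicator_def intro!: nn_integral_cong)
      qed
      finally show ?thesis .
    qed
    show ?thesis unfolding lc[OF A] lc[OF B]
    proof (rule nn_integral_mono, rule mult_right_mono)
      fix l :: real
      define S where "S = {s. 0 < s \<and> s < t \<and> l < W s}"
      have "(\<integral>\<^sup>+s. ennreal (A s) * indicator S s \<partial>lborel) \<le> (\<integral>\<^sup>+s. ennreal (B s) * indicator S s \<partial>lborel)"
      proof (cases "S = {}")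
        case True then show ?thesis by simp
      next
        case False
        have S: "S \<subseteq> {0<..<t}" by (auto simp: S_def)
        have dc: "y \<in> S" if "x \<in> S" "0 < y" "y \<le> x" for x y
          using that Wm[of y x] by (auto simp: S_def)
        obtain x where x: "x \<in> S" using False by auto
        have "bdd_above S" by (rule bdd_above_mono[OF bdd_above_Ioo S])
        then have "x \<le> Sup S" using x by (rule cSup_upper[rotated])
        moreover have "Sup S \<le> t" using S by (intro cSup_least False) auto
        ultimately have r: "0 < Sup S" "Sup S < 1" using x t by (auto simp: S_def)
        have eq: "(\<integral>\<^sup>+s. F s * indicator S s \<partial>lborel) = (\<integral>\<^sup>+s. F s * indicator {0<..<Sup S} s \<partial>lborel)" for F
          by (rule nn_integral_down_closed_eq[OF S _ False]) (rule dc)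
        show ?thesis unfolding eq by (rule step1[OF r])
      qed
      then show "(\<integral>\<^sup>+s. ennreal (A s) * indicator {s. 0 < s \<and> s < t \<and> l < W s} s \<partial>lborel) \<le> (\<integral>\<^sup>+s. ennreal (B s) * indicator {s. 0 < s \<and> s < t \<and> l < W s} s \<partial>lborel)"
        by (simp add: S_def)
    qed simp
  qed
  show ?thesis
  proof (cases "q = 1")
    case True
    have "(\<integral>\<^sup>+s\<in>{0<..<t}. ennreal (C s powr q) \<partial>lborel) = (\<integral>\<^sup>+s. ennreal (C s) * indicator {0<..<t} s \<partial>lborel)"
      if "\<And>s. 0 < s \<Longrightarrow> s < 1 \<Longrightarrow> 0 \<le> C s" for C
      using that True t by (intro nn_integral_cong) (auto simp: indicator_def)
    from this[OF A0] this[OF B0] step1[OF t] show ?thesis by simp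
  next
    case False
    then have q1: "1 < q" using q by simp
    define p where "p = q / (q - 1)"
    have p: "1 < p" "1/p + 1/q = 1" using q1 by (auto simp: p_def field_simps)
    define X where "X = (\<integral>\<^sup>+s\<in>{0<..<t}. ennreal (A s powr q) \<partial>lborel)"
    define Y where "Y = (\<integral>\<^sup>+s\<in>{0<..<t}. ennreal (B s powr q) \<partial>lborel)"
    have "(\<integral>\<^sup>+s\<in>{0<..<1}. ennreal (A s - L) \<partial>lborel) \<le> (\<integral>\<^sup>+s\<in>{0<..<1}. ennreal (B s - L) \<partial>lborel)"
      by (rule le[OF L])
    also have "\<dots> = (\<integral>\<^sup>+s. 0 \<partial>(lborel :: real measure))"
      by (intro nn_integral_cong) (use BL in \<open>auto simp: indicator_def ennreal_neg\<close>)
    finally have "(\<integral>\<^sup>+s\<in>{0<..<1}. ennreal (A s - L) \<partial>lborel) = 0" by simp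
    then have AL: "AE s in lborel. ennreal (A s - L) * indicator {0<..<1} s = 0"
      by (subst (asm) nn_integral_0_iff_AE) auto
    have "X \<le> (\<integral>\<^sup>+s. ennreal (L powr q) * indicator {0<..<t} s \<partial>lborel)" unfolding X_def
    proof (rule nn_integral_mono_AE)
      show "AE s in lborel. ennreal (A s powr q) * indicator {0<..<t} s \<le> ennreal (L powr q) * indicator {0<..<t} s"
        using AL
      proof eventually_elim
        case (elim s)
        show ?case
        proof (cases "0 < s \<and> s < t")
          case True
          with elim t have "A s \<le> L" by (auto simp: indicator_def ennreal_eq_0_iff)
          then have "A s powr q \<le> L powr q" using A0[of s] True t q by (intro powr_mono2) auto
          then show ?thesis by (auto simp: indicator_def ennreal_leI)
        qed (auto simp: indicator_def)
      qed
    qed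
    also have "\<dots> < \<infinity>" using t by (subst nn_integral_cmult_indicator) (auto simp: ennreal_mult_less_top)
    finally have Xfin: "X < \<infinity>" .
    have "X = (\<integral>\<^sup>+s. ennreal (A s powr (q - 1)) * (ennreal (A s) * indicator {0<..<t} s) \<partial>lborel)"
      unfolding X_def
    proof (rule nn_integral_cong)
      fix s
      show "ennreal (A s powr q) * indicator {0<..<t} s = ennreal (A s powr (q - 1)) * (ennreal (A s) * indicator {0<..<t} s)"
      proof (cases "0 < s \<and> s < t")
        case True
        then have "0 \<le> A s" using A0[of s] t by simp
        moreover from this have "A s powr q = A s powr (q - 1) * A s" using q1 by (simp add: powr_mult_base mult.commute)
        ultimately show ?thesis by (simp add: ennreal_mult mult.assoc)
      qed (auto simp: indicator_def)
    qed
    also have "\<dots> \<le> (\<integral>\<^sup>+s. ennreal (A s powr (q - 1)) * (ennreal (B s) * indicator {0<..<t} s) \<partial>lborel)"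
      by (rule step2) (use A0 Am t q1 in \<open>auto intro!: powr_mono2\<close>)
    also have "\<dots> \<le> (\<integral>\<^sup>+s. ennreal (1/p) * (ennreal (A s powr q) * indicator {0<..<t} s)
                     + ennreal (1/q) * (ennreal (B s powr q) * indicator {0<..<t} s) \<partial>lborel)"
    proof (rule nn_integral_mono)
      fix s
      show "ennreal (A s powr (q - 1)) * (ennreal (B s) * indicator {0<..<t} s) \<le> ennreal (1/p) * (ennreal (A s powr q) * indicator {0<..<t} s)
                     + ennreal (1/q) * (ennreal (B s powr q) * indicator {0<..<t} s)"
      proof (cases "0 < s \<and> s < t")
        case True
        then have nn: "0 \<le> A s" "0 \<le> B s" using A0[of s] B0[of s] t by auto
        have "A s powr (q - 1) * B s \<le> (A s powr (q - 1)) powr p / p + B s powr q / q"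
          by (rule Youngs_inequality) (use p q1 nn in auto)
        also have "(A s powr (q - 1)) powr p = A s powr q" using q1 by (simp add: powr_powr p_def)
        finally have "ennreal (A s powr (q - 1) * B s) \<le> ennreal (A s powr q / p + B s powr q / q)" by (rule ennreal_leI)
        then show ?thesis using True nn p q1 
          by (simp add: ennreal_mult[symmetric] ennreal_plus[symmetric] del: ennreal_plus)
      qed (auto simp: indicator_def)
    qed
    also have "\<dots> = ennreal (1/p) * X + ennreal (1/q) * Y"
      unfolding X_def Y_def by (simp add: nn_integral_add nn_integral_cmult)
    finally have XY: "X \<le> ennreal (1/p) * X + ennreal (1/q) * Y" .
    show ?thesis unfolding X_def[symmetric] Y_def[symmetric]
    proof (cases "Y = \<infinity>")
      case False
      then obtain y where y: "Y = ennreal y" "0 \<le> y" by (cases Y) auto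
      obtain x where x: "X = ennreal x" "0 \<le> x" using Xfin by (cases X) auto
      have "ennreal x \<le> ennreal (1/p * x + 1/q * y)"
        using XY p q1 unfolding x(1) y(1) using x(2) y(2)
        by (simp add: ennreal_mult[symmetric] ennreal_plus[symmetric] del: ennreal_plus)
      then have "x \<le> 1/p * x + 1/q * y" using x y p q1 by (simp add: ennreal_le_iff del: ennreal_plus)
      moreover have "1/p = 1 - 1/q" using p by simp
      ultimately have "1/q * x \<le> 1/q * y" by (simp add: algebra_simps)
      then have "x \<le> y" using q1 by (simp add: divide_le_cancel)
      then show "X \<le> Y" using x y by (simp add: ennreal_leI)
    qed simp
  qed
qed

text \<open>Young's inequality for \<open>X\<close> and \<open>G\<close>, divided by their norms \<open>\<alpha>\<close> and \<open>\<beta>\<close>.\<close>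

lemma nn_integral_Holder:
  fixes X G :: "'b \<Rightarrow> real"
  assumes X[measurable]: "X \<in> borel_measurable N" and G[measurable]: "G \<in> borel_measurable N"
    and X0: "\<And>s. 0 \<le> X s" and G0: "\<And>s. 0 \<le> G s"
    and q: "1 < q" and p: "p = q / (q - 1)"
    and a: "(\<integral>\<^sup>+s. ennreal (X s powr p) \<partial>N) = ennreal a" "0 \<le> a"
    and b: "(\<integral>\<^sup>+s. ennreal (G s powr q) \<partial>N) = ennreal b" "0 \<le> b"
  shows "(\<integral>\<^sup>+s. ennreal (X s * G s) \<partial>N) \<le> ennreal (a powr (1/p) * b powr (1/q))"
proof -
  have p1: "1 < p" "1/p + 1/q = 1" using q by (auto simp: p field_simps)
  consider "a = 0" | "b = 0" | "0 < a" "0 < b" using a b by fastforce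
  then show ?thesis
  proof cases
    case 1
    then have "AE s in N. ennreal (X s powr p) = 0" using a by (intro iffD1[OF nn_integral_0_iff_AE]) auto
    then have "(\<integral>\<^sup>+s. ennreal (X s * G s) \<partial>N) = (\<integral>\<^sup>+s. 0 \<partial>N)"
      by (intro nn_integral_cong_AE) (auto simp: ennreal_eq_0_iff elim!: eventually_mono)
    then show ?thesis by simp
  next
    case 2
    then have "AE s in N. ennreal (G s powr q) = 0" using b by (intro iffD1[OF nn_integral_0_iff_AE]) auto
    then have "(\<integral>\<^sup>+s. ennreal (X s * G s) \<partial>N) = (\<integral>\<^sup>+s. 0 \<partial>N)"
      by (intro nn_integral_cong_AE) (auto simp: ennreal_eq_0_iff elim!: eventually_mono)
    then show ?thesis by simp
  next
    case 3
    define \<alpha> where "\<alpha> = a powr (1/p)"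
    define \<beta> where "\<beta> = b powr (1/q)"
    have ab: "0 < \<alpha>" "0 < \<beta>" "\<alpha> powr p = a" "\<beta> powr q = b"
      using 3 p1 q by (auto simp: \<alpha>_def \<beta>_def powr_powr)
    have "X s * G s \<le> \<alpha> * \<beta> / (a * p) * X s powr p + \<alpha> * \<beta> / (b * q) * G s powr q" for s
    proof -
      have "(X s / \<alpha>) * (G s / \<beta>) \<le> (X s / \<alpha>) powr p / p + (G s / \<beta>) powr q / q"
        by (rule Youngs_inequality) (use p1 q X0 G0 ab in auto)
      then have "\<alpha> * \<beta> * ((X s / \<alpha>) * (G s / \<beta>)) \<le> \<alpha> * \<beta> * ((X s / \<alpha>) powr p / p + (G s / \<beta>) powr q / q)"
        using ab by (intro mult_left_mono) auto
      then show ?thesis using ab X0 G0 by (simp add: powr_divide algebra_simps)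
    qed
    then have "(\<integral>\<^sup>+s. ennreal (X s * G s) \<partial>N) \<le> (\<integral>\<^sup>+s. ennreal (\<alpha> * \<beta> / (a * p)) * ennreal (X s powr p) + ennreal (\<alpha> * \<beta> / (b * q)) * ennreal (G s powr q) \<partial>N)"
      using ab 3 p1 q by (intro nn_integral_mono) (simp add: ennreal_mult[symmetric] ennreal_plus[symmetric] ennreal_leI del: ennreal_plus)
    also have "\<dots> = ennreal (\<alpha> * \<beta> / (a * p)) * ennreal a + ennreal (\<alpha> * \<beta> / (b * q)) * ennreal b"
      by (simp add: nn_integral_add nn_integral_cmult a b)
    also have "\<dots> = ennreal (\<alpha> * \<beta> / (a * p) * a + \<alpha> * \<beta> / (b * q) * b)"
      using ab 3 p1 q by (simp add: ennreal_mult[symmetric] ennreal_plus[symmetric] del: ennreal_plus)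
    also have "\<alpha> * \<beta> / (a * p) * a + \<alpha> * \<beta> / (b * q) * b = \<alpha> * \<beta> * (1/p + 1/q)"
      using 3 by (simp add: field_simps)
    finally show ?thesis unfolding p1(2) by (simp add: \<alpha>_def \<beta>_def)
  qed
qed

section \<open>Regularity of the rearrangement of a Lipschitz function\<close>

locale lipschitz_isoperimetric =
  fixes M :: "'a::metric_space measure" and I :: "real \<Rightarrow> real" and f :: "'a \<Rightarrow> real" and L :: real
  assumes prob_M: "prob_space M" and sets_M: "sets M = sets borel"
    and minorant: "isoperimetric_minorant M I"
    and continuous_I: "continuous_on {0..1} I"
    and positive_I: "\<And>s. 0 < s \<Longrightarrow> s < 1 \<Longrightarrow> 0 < I s"
    and lipschitz_f: "L-lipschitz_on UNIV f"
    and flat: "\<And>g c. g \<in> Lip \<Longrightarrow> AE x in M. g x = c \<longrightarrow> grad_norm g x = 0"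
begin

sublocale prob_space M by (rule prob_M)

abbreviation \<phi> :: "real \<Rightarrow> real" where "\<phi> \<equiv> rearr M f"
abbreviation H :: "'a \<Rightarrow> real" where "H \<equiv> grad_norm f"

definition shell :: "real \<Rightarrow> real \<Rightarrow> 'a set" where
  "shell a b = {x. \<phi> b < \<bar>f x\<bar> \<and> \<bar>f x\<bar> < \<phi> a}"

lemma space_M: "space M = UNIV"
  using sets_eq_imp_space_eq[OF sets_M] by simp

lemma measurable_f[measurable]: "f \<in> borel_measurable M"
  unfolding measurable_cong_sets[OF sets_M refl]
  by (rule borel_measurable_continuous_onI[OF lipschitz_on_continuous_on[OF lipschitz_f]])

lemma measurable_H[measurable]: "H \<in> borel_measurable M"
  unfolding measurable_cong_sets[OF sets_M refl] by (rule borel_measurable_grad_norm[OF lipschitz_f])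

lemma shell_sets[measurable]: "shell a b \<in> sets M"
proof -
  have "{x \<in> space M. \<phi> b < \<bar>f x\<bar> \<and> \<bar>f x\<bar> < \<phi> a} \<in> sets M" by measurable
  then show ?thesis by (simp add: shell_def space_M)
qed

lemma H_nonneg: "0 \<le> H x" by (rule grad_norm_nonneg[OF lipschitz_f])
lemma H_le: "H x \<le> L" by (rule grad_norm_le[OF lipschitz_f])
lemma L_nonneg: "0 \<le> L" using lipschitz_on_nonneg[OF lipschitz_f] .

lemmas \<phi>_antimono = rearr_antimono[OF finite_measure_axioms measurable_f]
lemmas \<phi>_nonneg = rearr_nonneg[OF finite_measure_axioms measurable_f]
lemmas less_\<phi>_iff = less_rearr_iff[OF finite_measure_axioms measurable_f]

text \<open>The coarea inequality for the truncation of \<open>|f|\<close> between the levels \<open>c\<close> and \<open>d\<close>.  The truncation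
  is the composition of \<open>f\<close> with a contraction, so its gradient is at most \<open>H\<close>; where it takes the value
  \<open>c\<close> or \<open>d\<close>, its gradient vanishes almost everywhere by the assumption \<open>flat\<close>.\<close>

lemma profile_level_integral_le:
  assumes "0 \<le> c" "c \<le> d"
  shows "(\<integral>\<^sup>+s\<in>{c<..<d}. ennreal (I (distr_fun M f s)) \<partial>lborel)
    \<le> (\<integral>\<^sup>+x\<in>{x. c < \<bar>f x\<bar> \<and> \<bar>f x\<bar> < d}. ennreal (H x) \<partial>M)"
proof -
  define u where "u x = min (max \<bar>f x\<bar> c) d" for x
  have contr: "\<bar>u x - u y\<bar> \<le> \<bar>f x - f y\<bar>" for x y unfolding u_def by linarith
  have lip: "L-lipschitz_on UNIV u"
  proof (rule lipschitz_onI)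
    fix x y
    have "\<bar>u x - u y\<bar> \<le> L * dist x y"
      using contr[of x y] lipschitz_abs_diff_le[OF lipschitz_f, of x y] by linarith
    then show "dist (u x) (u y) \<le> L * dist x y" by (simp add: dist_real_def)
  qed (rule L_nonneg)
  then have uLip: "u \<in> Lip" by (auto simp: Lip_def)
  have "(\<integral>\<^sup>+s\<in>{c<..<d}. ennreal (I (distr_fun M f s)) \<partial>lborel)
      \<le> (\<integral>\<^sup>+s. ennreal (I (measure M {x. s < u x})) \<partial>lborel)"
  proof (rule nn_integral_mono)
    fix s
    have "{x. s < u x} = {x. s < \<bar>f x\<bar>}" if "c < s" "s < d" using that by (auto simp: u_def)
    then show "ennreal (I (distr_fun M f s)) * indicator {c<..<d} s \<le> ennreal (I (measure M {x. s < u x}))"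
      by (auto simp: indicator_def distr_fun_def space_M)
  qed
  also have "\<dots> \<le> (\<integral>\<^sup>+x. ennreal (grad_norm u x) \<partial>M)"
    by (rule coarea_inequality[OF finite_measure_axioms sets_M lip minorant])
  also have "\<dots> \<le> (\<integral>\<^sup>+x\<in>{x. c < \<bar>f x\<bar> \<and> \<bar>f x\<bar> < d}. ennreal (H x) \<partial>M)"
  proof (rule nn_integral_mono_AE)
    show "AE x in M. ennreal (grad_norm u x) \<le> ennreal (H x) * indicator {x. c < \<bar>f x\<bar> \<and> \<bar>f x\<bar> < d} x"
      using flat[OF uLip, of c] flat[OF uLip, of d]
    proof eventually_elim
      case (elim x)
      have "grad_norm u x \<le> H x" by (rule grad_norm_mono[OF lipschitz_f lip contr])
      moreover have "u x = c \<or> u x = d \<or> (c < \<bar>f x\<bar> \<and> \<bar>f x\<bar> < d)" using assms by (auto simp: u_def)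
      ultimately show ?case using elim by (auto simp: indicator_def ennreal_leI)
    qed
  qed
  finally show ?thesis .
qed

text \<open>By equimeasurability the shell is as large as the set of all \<open>s\<close> with \<open>\<phi> b < \<phi> s < \<phi> a\<close>, and
  monotonicity confines these \<open>s\<close> to \<open>[a,b]\<close>.\<close>

lemma measure_shell_le:
  assumes "0 < a" "a \<le> b" "b < 1"
  shows "measure M (shell a b) \<le> b - a"
proof -
  have "emeasure M (shell a b) = (\<integral>\<^sup>+x. indicator {\<phi> b<..<\<phi> a} \<bar>f x\<bar> \<partial>M)"
  proof -
    have "emeasure M (shell a b) = (\<integral>\<^sup>+x. indicator (shell a b) x \<partial>M)" by simp
    also have "\<dots> = (\<integral>\<^sup>+x. indicator {\<phi> b<..<\<phi> a} \<bar>f x\<bar> \<partial>M)"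
      by (intro nn_integral_cong) (auto simp: shell_def indicator_def)
    finally show ?thesis .
  qed
  also have "\<dots> = (\<integral>\<^sup>+s\<in>{0<..<1}. indicator {\<phi> b<..<\<phi> a} (\<phi> s) \<partial>lborel)"
    by (rule nn_integral_rearr[OF prob_M measurable_f, symmetric]) auto
  also have "\<dots> \<le> (\<integral>\<^sup>+s. indicator {a..b} s \<partial>lborel)"
  proof (rule nn_integral_mono)
    fix s
    have "a \<le> s" if "0 < s" "\<phi> s < \<phi> a" using that \<phi>_antimono[of s a] by linarith
    moreover have "s \<le> b" if "0 < s" "\<phi> b < \<phi> s" using that \<phi>_antimono[of b s] assms by linarith
    ultimately show "indicator {\<phi> b<..<\<phi> a} (\<phi> s) * indicator {0<..<1} s \<le> (indicator {a..b} s :: ennreal)"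
      by (auto simp: indicator_def)
  qed
  also have "\<dots> = ennreal (b - a)" using assms by simp
  finally show ?thesis using assms by (simp add: emeasure_eq_measure)
qed

text \<open>For levels \<open>s\<close> strictly between \<open>\<phi> b\<close> and \<open>\<phi> a\<close>, the Galois connection puts \<open>distr_fun M f s\<close> into
  \<open>[a,b]\<close>, where \<open>I\<close> is at least \<open>m\<close>.\<close>

lemma drop_le_shell_integral:
  assumes ab: "0 < a" "a \<le> b" "b < 1" and m: "0 \<le> m" "\<And>r. a \<le> r \<Longrightarrow> r \<le> b \<Longrightarrow> m \<le> I r"
  shows "ennreal (m * (\<phi> a - \<phi> b)) \<le> (\<integral>\<^sup>+x\<in>shell a b. ennreal (H x) \<partial>M)"
proof -
  have \<phi>: "0 \<le> \<phi> b" "\<phi> b \<le> \<phi> a" using ab \<phi>_nonneg[of b] \<phi>_antimono[of a b] by auto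
  have "ennreal (m * (\<phi> a - \<phi> b)) = (\<integral>\<^sup>+s. ennreal m * indicator {\<phi> b<..<\<phi> a} s \<partial>lborel)"
    using \<phi> m by (subst nn_integral_cmult_indicator) (auto simp: ennreal_mult)
  also have "\<dots> \<le> (\<integral>\<^sup>+s\<in>{\<phi> b<..<\<phi> a}. ennreal (I (distr_fun M f s)) \<partial>lborel)"
  proof (rule nn_integral_mono)
    fix s
    have "m \<le> I (distr_fun M f s)" if s: "\<phi> b < s" "s < \<phi> a"
    proof (rule m(2))
      show "a \<le> distr_fun M f s" using less_\<phi>_iff[of a s] s \<phi> ab by auto
      show "distr_fun M f s \<le> b" using less_\<phi>_iff[of b s] s \<phi> ab by auto
    qed
    then show "ennreal m * indicator {\<phi> b<..<\<phi> a} s \<le> ennreal (I (distr_fun M f s)) * indicator {\<phi> b<..<\<phi> a} s"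
      by (auto simp: indicator_def ennreal_leI)
  qed
  also have "\<dots> \<le> (\<integral>\<^sup>+x\<in>shell a b. ennreal (H x) \<partial>M)"
    unfolding shell_def by (rule profile_level_integral_le[OF \<phi>])
  finally show ?thesis .
qed

text \<open>The constant \<open>k\<close> may be subtracted on both sides because the shell is no larger than \<open>b - a\<close>.\<close>

lemma excess_drop_le_shell_integral:
  assumes ab: "0 < a" "a \<le> b" "b < 1" and m: "0 \<le> m" "\<And>r. a \<le> r \<Longrightarrow> r \<le> b \<Longrightarrow> m \<le> I r"
    and k: "0 \<le> k"
  shows "ennreal (m * (\<phi> a - \<phi> b) - k * (b - a)) \<le> (\<integral>\<^sup>+x\<in>shell a b. ennreal (H x - k) \<partial>M)"
proof -
  have "ennreal (m * (\<phi> a - \<phi> b)) \<le> (\<integral>\<^sup>+x\<in>shell a b. ennreal (H x) \<partial>M)"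
    by (rule drop_le_shell_integral[OF ab m])
  also have "\<dots> \<le> (\<integral>\<^sup>+x. ennreal k * indicator (shell a b) x + ennreal (H x - k) * indicator (shell a b) x \<partial>M)"
  proof (rule nn_integral_mono)
    fix x
    have "ennreal (H x) \<le> ennreal k + ennreal (H x - k)"
      using k by (cases "k \<le> H x") (auto simp: ennreal_plus[symmetric] ennreal_neg ennreal_leI simp del: ennreal_plus)
    then show "ennreal (H x) * indicator (shell a b) x \<le> ennreal k * indicator (shell a b) x + ennreal (H x - k) * indicator (shell a b) x"
      by (auto simp: indicator_def)
  qed
  also have "\<dots> = ennreal k * emeasure M (shell a b) + (\<integral>\<^sup>+x\<in>shell a b. ennreal (H x - k) \<partial>M)"
    by (subst nn_integral_add) (auto simp: nn_integral_cmult_indicator)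
  also have "ennreal k * emeasure M (shell a b) \<le> ennreal (k * (b - a))"
    using measure_shell_le[OF ab] k ab
    by (auto simp: emeasure_eq_measure ennreal_mult[symmetric] intro!: ennreal_leI mult_left_mono)
  finally have "ennreal (m * (\<phi> a - \<phi> b)) \<le> ennreal (k * (b - a)) + (\<integral>\<^sup>+x\<in>shell a b. ennreal (H x - k) \<partial>M)"
    by (simp add: add_right_mono)
  moreover have "0 \<le> k * (b - a)" using k ab by simp
  ultimately show ?thesis
    by (subst ennreal_minus[symmetric]) (auto simp: ennreal_minus_le_iff)
qed

text \<open>Apply \<open>excess_drop_le_shell_integral\<close> with \<open>k = L\<close>: as \<open>H \<le> L\<close>, the right-hand side is \<open>0\<close>.\<close>

lemma rearr_locally_lipschitz:
  assumes "0 < a" "a \<le> b" "b < 1"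
  obtains K where "K-lipschitz_on {a..b} \<phi>"
proof -
  have c: "compact (I ` {a..b})"
    by (rule compact_continuous_image) (use assms in \<open>auto intro: continuous_on_subset[OF continuous_I]\<close>)
  have ne: "I ` {a..b} \<noteq> {}" using assms by auto
  obtain m where m: "m \<in> I ` {a..b}" "\<And>y. y \<in> I ` {a..b} \<Longrightarrow> m \<le> y"
    using compact_attains_inf[OF c ne] by metis
  have m0: "0 < m" using m(1) positive_I assms by auto
  have *: "\<bar>\<phi> x - \<phi> y\<bar> \<le> L / m * (y - x)" if xy: "a \<le> x" "x \<le> y" "y \<le> b" for x y
  proof -
    have xy0: "0 < x" "y < 1" using xy assms by auto
    have "ennreal (m * (\<phi> x - \<phi> y) - L * (y - x)) \<le> (\<integral>\<^sup>+x\<in>shell x y. ennreal (H x - L) \<partial>M)"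
      by (rule excess_drop_le_shell_integral) (use xy xy0 m m0 L_nonneg in auto)
    also have "\<dots> = (\<integral>\<^sup>+x. 0 \<partial>M)"
      by (intro nn_integral_cong) (simp add: ennreal_neg H_le)
    finally have "m * (\<phi> x - \<phi> y) \<le> L * (y - x)" by (simp add: ennreal_eq_0_iff)
    then have "\<phi> x - \<phi> y \<le> L / m * (y - x)" using m0 by (simp add: field_simps)
    moreover have "\<phi> y \<le> \<phi> x" using \<phi>_antimono[of x y] xy xy0 by simp
    ultimately show ?thesis by simp
  qed
  have "(L / m)-lipschitz_on {a..b} \<phi>"
  proof (rule lipschitz_onI)
    fix x y assume "x \<in> {a..b}" "y \<in> {a..b}"
    then show "dist (\<phi> x) (\<phi> y) \<le> L / m * dist x y"
      using *[of x y] *[of y x] by (cases "x \<le> y") (auto simp: dist_real_def abs_minus_commute)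
  qed (use L_nonneg m0 in auto)
  then show ?thesis by (rule that)
qed

lemma clamped_rearr_lipschitz:
  assumes "0 < a" "a \<le> b" "b < 1"
  obtains K where "K-lipschitz_on UNIV (\<lambda>s. \<phi> (max a (min b s)))"
proof -
  obtain K where K: "K-lipschitz_on {a..b} \<phi>" using rearr_locally_lipschitz[OF assms] .
  have "K-lipschitz_on UNIV (\<lambda>s. \<phi> (max a (min b s)))"
  proof (rule lipschitz_onI)
    fix x y :: real
    have "dist (\<phi> (max a (min b x))) (\<phi> (max a (min b y))) \<le> K * dist (max a (min b x)) (max a (min b y))"
      by (rule lipschitz_onD[OF K]) (use assms in auto)
    also have "\<dots> \<le> K * dist x y"
      by (rule mult_left_mono[OF _ lipschitz_on_nonneg[OF K]]) (auto simp: dist_real_def)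
    finally show "dist (\<phi> (max a (min b x))) (\<phi> (max a (min b y))) \<le> K * dist x y" .
  qed (rule lipschitz_on_nonneg[OF K])
  then show ?thesis by (rule that)
qed

text \<open>A Borel function that equals \<open>-\<phi>'\<close> at every point of \<open>(0,1)\<close> where \<open>\<phi>\<close> is differentiable.
  Outside \<open>(0,1)\<close>, where \<open>\<phi>\<close> need not be monotone, \<open>\<phi>\<close> is replaced by \<open>0\<close> to make the difference
  quotients measurable.\<close>

definition neg_slope :: "real \<Rightarrow> real" where
  "neg_slope s = lim (\<lambda>n. real (Suc n) * (\<phi> s * indicator {0<..<1} s
      - \<phi> (s + 1 / real (Suc n)) * indicator {0<..<1} (s + 1 / real (Suc n))))"

lemma measurable_neg_slope[measurable]: "neg_slope \<in> borel_measurable borel"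
proof -
  have [measurable]: "(\<lambda>s. \<phi> s * indicator {0<..<1} s) \<in> borel_measurable borel"
    by (rule borel_measurable_rearr[OF finite_measure_axioms measurable_f])
  have "(\<lambda>s. \<phi> (s + 1 / real (Suc n)) * indicator {0<..<1} (s + 1 / real (Suc n))) \<in> borel_measurable borel" for n
    by (rule measurable_compose[of "\<lambda>s. s + 1 / real (Suc n)" borel borel "\<lambda>s. \<phi> s * indicator {0<..<1} s"]) measurable
  then show ?thesis unfolding neg_slope_def[abs_def] by measurable
qed

lemma neg_slope_eq:
  assumes d: "(\<phi> has_real_derivative d) (at s)" and s: "0 < s" "s < 1"
  shows "neg_slope s = - d"
proof -
  define h where "h n = 1 / real (Suc n)" for n
  have h: "h n > 0" for n by (simp add: h_def)
  have hnz: "h n \<noteq> 0" for n by (simp add: h_def)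
  have hlim: "h \<longlonglongrightarrow> 0" unfolding h_def using LIMSEQ_inverse_real_of_nat by (simp add: inverse_eq_divide)
  have "filterlim h (at 0) sequentially" using hlim hnz by (simp add: filterlim_at)
  moreover have "((\<lambda>t. (\<phi> (s + t) - \<phi> s) / t) \<longlongrightarrow> d) (at 0)" using d by (simp add: DERIV_def)
  ultimately have "(\<lambda>n. (\<phi> (s + h n) - \<phi> s) / h n) \<longlonglongrightarrow> d" by (rule filterlim_compose[rotated])
  then have "(\<lambda>n. - ((\<phi> (s + h n) - \<phi> s) / h n)) \<longlonglongrightarrow> - d" by (rule tendsto_minus)
  moreover have "\<forall>\<^sub>F n in sequentially. - ((\<phi> (s + h n) - \<phi> s) / h n) = real (Suc n) * (\<phi> s * indicator {0<..<1} s
      - \<phi> (s + 1 / real (Suc n)) * indicator {0<..<1} (s + 1 / real (Suc n)))"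
  proof -
    have "\<forall>\<^sub>F n in sequentially. h n < 1 - s" using hlim s by (intro order_tendstoD) auto
    then show ?thesis
    proof eventually_elim
      case (elim n)
      have "s + h n \<in> {0<..<1}" using elim s h[of n] by auto
      then show ?case using s by (simp add: h_def[symmetric]) (simp add: h_def field_simps)
    qed
  qed
  ultimately have "(\<lambda>n. real (Suc n) * (\<phi> s * indicator {0<..<1} s
      - \<phi> (s + 1 / real (Suc n)) * indicator {0<..<1} (s + 1 / real (Suc n)))) \<longlonglongrightarrow> - d"
    by (rule Lim_transform_eventually)
  then show ?thesis unfolding neg_slope_def by (rule limI)
qed

lemma AE_rearr_differentiable:
  "AE s in lborel. 0 < s \<and> s < 1 \<longrightarrow> (\<phi> has_real_derivative - neg_slope s) (at s) \<and> 0 \<le> neg_slope s"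
proof -
  \<comment> \<open>the intervals \<open>[1/(n + 3), 1 - 1/(n + 3)]\<close> exhaust \<open>(0,1)\<close> and are nonempty for every \<open>n\<close>\<close>
  have "AE s in lborel. \<forall>n::nat. (\<lambda>s. \<phi> (max (1 / real (n + 3)) (min (1 - 1 / real (n + 3)) s))) differentiable (at s)"
    unfolding AE_all_countable
  proof
    fix n :: nat
    obtain K where "K-lipschitz_on UNIV (\<lambda>s. \<phi> (max (1 / real (n + 3)) (min (1 - 1 / real (n + 3)) s)))"
      by (rule clamped_rearr_lipschitz[of "1 / real (n + 3)" "1 - 1 / real (n + 3)"]) (auto simp: field_simps)
    then show "AE s in lborel. (\<lambda>s. \<phi> (max (1 / real (n + 3)) (min (1 - 1 / real (n + 3)) s))) differentiable (at s)"
      by (rule lipschitz_AE_differentiable)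
  qed
  then show ?thesis
  proof eventually_elim
    case (elim s)
    show ?case
    proof
      assume s: "0 < s \<and> s < 1"
      then have "0 < min s (1 - s)" by auto
      then obtain n where n: "1 / real (Suc n) < min s (1 - s)" using nat_approx_posE by blast
      define e where "e = 1 / real (n + 3)"
      have "e < 1 / real (Suc n)" unfolding e_def by (intro divide_strict_left_mono) auto
      then have e: "e < s" "s < 1 - e" using n by auto
      obtain d where "((\<lambda>s. \<phi> (max e (min (1 - e) s))) has_real_derivative d) (at s)"
        using elim[THEN spec, of n] by (auto simp: real_differentiable_def e_def)
      then have d: "(\<phi> has_real_derivative d) (at s)"
        by (rule has_field_derivative_transform_within_open[where S = "{e<..<1 - e}"]) (use e in auto)
      have ns: "neg_slope s = - d" using neg_slope_eq[OF d] s by simp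
      have "d \<le> 0"
      proof (rule ccontr)
        assume "\<not> d \<le> 0"
        then obtain r where r: "0 < r" "\<And>h. 0 < h \<Longrightarrow> h < r \<Longrightarrow> \<phi> s < \<phi> (s + h)"
          using DERIV_pos_inc_right[OF d] by auto
        from r(2)[of "r/2"] r(1) \<phi>_antimono[of s "s + r/2"] s show False by auto
      qed
      then show "(\<phi> has_real_derivative - neg_slope s) (at s) \<and> 0 \<le> neg_slope s" using d ns by simp
    qed
  qed
qed

text \<open>The fundamental theorem of calculus for \<open>\<phi>\<close>, extended beyond \<open>[a,b]\<close> by constants so that it
  is Lipschitz on the whole line.\<close>

lemma rearr_drop_eq_integral:
  assumes ab: "0 < a" "a \<le> b" "b < 1"
  shows "ennreal (\<phi> a - \<phi> b) = (\<integral>\<^sup>+s\<in>{a..b}. ennreal (neg_slope s) \<partial>lborel)"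
proof -
  define g where "g s = \<phi> (max a (min b s))" for s
  define D where "D s = - neg_slope s * indicator {a<..<b} s" for s
  obtain K where K: "K-lipschitz_on UNIV g" using clamped_rearr_lipschitz[OF ab] unfolding g_def .
  have Dm[measurable]: "D \<in> borel_measurable borel" unfolding D_def[abs_def] by measurable
  have "AE s in lborel. (g has_real_derivative D s) (at s)"
    using AE_rearr_differentiable AE_lborel_singleton[of a] AE_lborel_singleton[of b]
  proof eventually_elim
    case (elim s)
    consider "s < a" | "a < s" "s < b" | "b < s" using elim by linarith
    then show ?case
    proof cases
      case 1
      have "((\<lambda>_. \<phi> a) has_real_derivative 0) (at s)" by simp
      then have "(g has_real_derivative 0) (at s)"
        by (rule has_field_derivative_transform_within_open[where S = "{..<a}"]) (use 1 ab in \<open>auto simp: g_def\<close>)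
      then show ?thesis using 1 by (simp add: D_def)
    next
      case 2
      then have "(\<phi> has_real_derivative - neg_slope s) (at s)" using elim ab by auto
      then have "(g has_real_derivative - neg_slope s) (at s)"
        by (rule has_field_derivative_transform_within_open[where S = "{a<..<b}"]) (use 2 in \<open>auto simp: g_def\<close>)
      then show ?thesis using 2 by (simp add: D_def)
    next
      case 3
      have "((\<lambda>_. \<phi> b) has_real_derivative 0) (at s)" by simp
      then have "(g has_real_derivative 0) (at s)"
        by (rule has_field_derivative_transform_within_open[where S = "{b<..}"]) (use 3 ab in \<open>auto simp: g_def\<close>)
      then show ?thesis using 3 by (simp add: D_def)
    qed
  qed
  note FTC = lipschitz_FTC[OF K Dm this ab(2)]
  have "(LINT x:{a..b}|lborel. D x) = \<phi> b - \<phi> a" using FTC(2) ab by (simp add: g_def)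
  then have eq: "(\<integral>x. - (indicator {a..b} x * D x) \<partial>lborel) = \<phi> a - \<phi> b"
    by (simp add: set_lebesgue_integral_def)
  have "(\<integral>\<^sup>+s\<in>{a..b}. ennreal (neg_slope s) \<partial>lborel) = (\<integral>\<^sup>+s. ennreal (- (indicator {a..b} s * D s)) \<partial>lborel)"
    using AE_lborel_singleton[of a] AE_lborel_singleton[of b]
    by (intro nn_integral_cong_AE) (auto elim!: eventually_elim2 simp: D_def indicator_def)
  also have "\<dots> = ennreal (\<integral>x. - (indicator {a..b} x * D x) \<partial>lborel)"
  proof (rule nn_integral_eq_integral)
    show "integrable lborel (\<lambda>s. - (indicator {a..b} s * D s))"
      using FTC(1) by (simp add: set_integrable_def)
    show "AE s in lborel. 0 \<le> - (indicator {a..b} s * D s)"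
      using AE_rearr_differentiable
      by eventually_elim (use ab in \<open>auto simp: D_def indicator_def\<close>)
  qed
  finally show ?thesis by (simp only: eq)
qed

section \<open>Majorization of the derivative by the gradient\<close>

lemma I_nonneg: "0 \<le> s \<Longrightarrow> s \<le> 1 \<Longrightarrow> 0 \<le> I s"
  using minorant by (auto simp: isoperimetric_minorant_def)

text \<open>Cut \<open>(0,1)\<close> into intervals of length \<open>1 / (n + 1)\<close> and omit the first and the last, since \<open>\<phi>\<close> may be
  unbounded at \<open>0\<close> and the interval inequality requires endpoints in \<open>(0,1)\<close>.  On each of the others
  let \<open>\<gamma>\<close> be the difference quotient of \<open>-\<phi>\<close> times the minimum of \<open>I\<close>.  The sum of the interval
  inequalities bounds the integral of the step function \<open>(\<gamma> - k)\<^sup>+\<close> by that of \<open>(H - k)\<^sup>+\<close>, because the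
  shells are disjoint.  Almost everywhere the step functions converge to the integrand on the left,
  by differentiability of \<open>\<phi>\<close> and continuity of \<open>I\<close>; Fatou's lemma concludes.  Positive parts are
  taken by \<open>ennreal\<close>, which maps negative numbers to \<open>0\<close>.\<close>

lemma excess_slope_integral_le:
  assumes k: "0 \<le> k"
  shows "(\<integral>\<^sup>+s\<in>{0<..<1}. ennreal (neg_slope s * I s - k) \<partial>lborel) \<le> (\<integral>\<^sup>+x. ennreal (H x - k) \<partial>M)"
proof -
  define p where "p n i = real i / real (Suc n)" for n i
  define m where "m n i = Inf (I ` {p n i..p n (Suc i)})" for n i
  define \<gamma> where "\<gamma> n i = m n i * (\<phi> (p n i) - \<phi> (p n (Suc i))) * real (Suc n)" for n i
  define P where "P n s = (\<Sum>i\<in>{1..<n}. ennreal (\<gamma> n i - k) * indicator {p n i..<p n (Suc i)} s)" for n s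
  have p_mono: "p n i \<le> p n j" if "i \<le> j" for n i j using that by (simp add: p_def divide_right_mono)
  have p_step: "p n (Suc i) - p n i = 1 / real (Suc n)" for n i by (simp add: p_def diff_divide_distrib[symmetric])
  have p_pos: "0 < p n i" if "1 \<le> i" for n i using that by (simp add: p_def)
  have p_lt1: "p n (Suc i) < 1" if "i < n" for n i using that by (simp add: p_def)
  have I_bdd: "bdd_below (I ` S)" if "S \<subseteq> {0..1}" for S
    using I_nonneg that by (intro bdd_belowI2[of _ 0]) auto
  have m_range: "{p n i..p n (Suc i)} \<subseteq> {0..1}" if "1 \<le> i" "i < n" for n i
    using p_pos[of i n] p_lt1[of i n] that by auto
  have m_ne: "{p n i..p n (Suc i)} \<noteq> {}" for n i using p_mono[of i "Suc i" n] by auto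
  have m_nonneg: "0 \<le> m n i" if "1 \<le> i" "i < n" for n i
    unfolding m_def using m_ne m_range[OF that] I_nonneg by (intro cINF_greatest) auto
  have m_le: "m n i \<le> I r" if "1 \<le> i" "i < n" "p n i \<le> r" "r \<le> p n (Suc i)" for n i r
    unfolding m_def using m_range[OF that(1,2)] that by (intro cINF_lower I_bdd) auto
  have Pm[measurable]: "P n \<in> borel_measurable borel" for n unfolding P_def[abs_def] by measurable
  have P_le: "(\<integral>\<^sup>+s. P n s \<partial>lborel) \<le> (\<integral>\<^sup>+x. ennreal (H x - k) \<partial>M)" for n
  proof -
    have disj: "disjoint_family_on (\<lambda>i. shell (p n i) (p n (Suc i))) {1..<n}"
    proof -
      have "shell (p n i) (p n (Suc i)) \<inter> shell (p n j) (p n (Suc j)) = {}" if "1 \<le> i" "i < j" for i j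
      proof -
        have "\<phi> (p n j) \<le> \<phi> (p n (Suc i))" using that by (intro \<phi>_antimono p_pos p_mono) auto
        then show ?thesis by (auto simp: shell_def)
      qed
      then show ?thesis unfolding disjoint_family_on_def
        by (metis Int_commute atLeastLessThan_iff linorder_neqE_nat)
    qed
    have "(\<integral>\<^sup>+s. P n s \<partial>lborel) = (\<Sum>i\<in>{1..<n}. ennreal (\<gamma> n i - k) * emeasure lborel {p n i..<p n (Suc i)})"
    proof -
      have "(\<integral>\<^sup>+s. P n s \<partial>lborel) = (\<Sum>i\<in>{1..<n}. \<integral>\<^sup>+s. ennreal (\<gamma> n i - k) * indicator {p n i..<p n (Suc i)} s \<partial>lborel)"
        unfolding P_def by (rule nn_integral_sum) measurable
      also have "\<dots> = (\<Sum>i\<in>{1..<n}. ennreal (\<gamma> n i - k) * emeasure lborel {p n i..<p n (Suc i)})"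
        by (intro sum.cong refl nn_integral_cmult_indicator) auto
      finally show ?thesis .
    qed
    also have "\<dots> \<le> (\<Sum>i\<in>{1..<n}. \<integral>\<^sup>+x\<in>shell (p n i) (p n (Suc i)). ennreal (H x - k) \<partial>M)"
    proof (rule sum_mono)
      fix i assume i: "i \<in> {1..<n}"
      have "ennreal (\<gamma> n i - k) * emeasure lborel {p n i..<p n (Suc i)} = ennreal (\<gamma> n i - k) * ennreal (1 / real (Suc n))"
        using p_mono[of i "Suc i" n] p_step[of n i] by simp
      also have "\<dots> = ennreal ((\<gamma> n i - k) * (1 / real (Suc n)))"
        by (rule ennreal_mult''[symmetric]) simp
      also have "(\<gamma> n i - k) * (1 / real (Suc n)) = m n i * (\<phi> (p n i) - \<phi> (p n (Suc i))) - k * (p n (Suc i) - p n i)"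
        unfolding p_step \<gamma>_def by (simp add: field_simps)
      also have "ennreal \<dots> \<le> (\<integral>\<^sup>+x\<in>shell (p n i) (p n (Suc i)). ennreal (H x - k) \<partial>M)"
        using i p_pos[of i n] p_lt1[of i n] p_mono[of i "Suc i" n] m_nonneg[of i n] m_le[of i n] k
        by (intro excess_drop_le_shell_integral) auto
      finally show "ennreal (\<gamma> n i - k) * emeasure lborel {p n i..<p n (Suc i)} \<le> (\<integral>\<^sup>+x\<in>shell (p n i) (p n (Suc i)). ennreal (H x - k) \<partial>M)" .
    qed
    also have "\<dots> = (\<integral>\<^sup>+x. (\<Sum>i\<in>{1..<n}. ennreal (H x - k) * indicator (shell (p n i) (p n (Suc i))) x) \<partial>M)"
      by (rule nn_integral_sum[symmetric]) measurable
    also have "\<dots> \<le> (\<integral>\<^sup>+x. ennreal (H x - k) \<partial>M)"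
    proof (rule nn_integral_mono)
      fix x
      have "(\<Sum>i\<in>{1..<n}. ennreal (H x - k) * indicator (shell (p n i) (p n (Suc i))) x)
        = ennreal (H x - k) * indicator (\<Union>i\<in>{1..<n}. shell (p n i) (p n (Suc i))) x"
        unfolding sum_distrib_left[symmetric] by (subst indicator_UN_disjoint[OF _ disj]) auto
      also have "\<dots> \<le> ennreal (H x - k)" by (auto simp: indicator_def)
      finally show "(\<Sum>i\<in>{1..<n}. ennreal (H x - k) * indicator (shell (p n i) (p n (Suc i))) x) \<le> ennreal (H x - k)" .
    qed
    finally show ?thesis .
  qed
  have lim: "(\<lambda>n. P n s) \<longlonglongrightarrow> ennreal (neg_slope s * I s - k)"
    if s: "0 < s" "s < 1" and d: "(\<phi> has_real_derivative - neg_slope s) (at s)" for s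
  proof -
    \<comment> \<open>the index of the partition interval that contains \<open>s\<close>\<close>
    define j where "j n = nat \<lfloor>s * real (Suc n)\<rfloor>" for n
    have j: "p n (j n) \<le> s" "s < p n (Suc (j n))" for n
    proof -
      have "real (j n) = of_int \<lfloor>s * real (Suc n)\<rfloor>" using s by (simp add: j_def)
      then have "real (j n) \<le> s * real (Suc n)" "s * real (Suc n) < real (j n) + 1" by linarith+
      then show "p n (j n) \<le> s" "s < p n (Suc (j n))" 
        by (simp_all add: p_def pos_divide_le_eq pos_less_divide_eq add.commute)
    qed
    have h: "(\<lambda>n. 1 / real (Suc n)) \<longlonglongrightarrow> 0" using LIMSEQ_inverse_real_of_nat by (simp add: inverse_eq_divide)
    have lima: "(\<lambda>n. p n (j n)) \<longlonglongrightarrow> s"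
    proof (rule tendsto_sandwich)
      show "\<forall>\<^sub>F n in sequentially. s - 1 / real (Suc n) \<le> p n (j n)"
        using j(2) p_step by (intro always_eventually allI) (smt (verit))
      show "\<forall>\<^sub>F n in sequentially. p n (j n) \<le> s" using j(1) by simp
      show "(\<lambda>n. s - 1 / real (Suc n)) \<longlonglongrightarrow> s" using tendsto_diff[OF tendsto_const h, of s] by simp
    qed simp
    have limb: "(\<lambda>n. p n (Suc (j n))) \<longlonglongrightarrow> s"
    proof -
      have "(\<lambda>n. p n (j n) + 1 / real (Suc n)) \<longlonglongrightarrow> s + 0" by (intro tendsto_add lima h)
      moreover have "p n (j n) + 1 / real (Suc n) = p n (Suc (j n))" for n using p_step[of n "j n"] by simp
      ultimately show ?thesis by simp
    qed
    have ev: "\<forall>\<^sub>F n in sequentially. 1 \<le> j n \<and> j n < n"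
    proof -
      have "\<forall>\<^sub>F n in sequentially. 1 / real (Suc n) < min s (1 - s)" using h s by (intro order_tendstoD) auto
      then show ?thesis
      proof eventually_elim
        case (elim n)
        have "0 < p n (j n)" using j(2)[of n] p_step[of n "j n"] elim by simp
        then have "1 \<le> j n" by (cases "j n") (auto simp: p_def)
        moreover have "p n (Suc (j n)) < 1" using j(1)[of n] p_step[of n "j n"] elim by simp
        then have "real (Suc (j n)) < real (Suc n)" by (simp add: p_def)
        then have "j n < n" by simp
        ultimately show ?case by simp
      qed
    qed
    have Peq: "P n s = ennreal (\<gamma> n (j n) - k)" if "1 \<le> j n \<and> j n < n" for n
    proof -
      have "indicator {p n i..<p n (Suc i)} s = (if i = j n then 1 else 0 :: ennreal)" for i
      proof -
        have *: "i = j n" if "p n i \<le> s" "s < p n (Suc i)"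
        proof (rule ccontr)
          assume "i \<noteq> j n"
          then consider "Suc i \<le> j n" | "Suc (j n) \<le> i" by linarith
          then show False
            using p_mono[of "Suc i" "j n" n] p_mono[of "Suc (j n)" i n] that j[of n] by cases auto
        qed
        show ?thesis
        proof (cases "i = j n")
          case True
          then show ?thesis using j by simp
        next
          case False
          with * have "s \<notin> {p n i..<p n (Suc i)}" by auto
          with False show ?thesis by simp
        qed
      qed
      then have "P n s = (\<Sum>i\<in>{1..<n}. if i = j n then ennreal (\<gamma> n i - k) else 0)"
        unfolding P_def by (intro sum.cong) auto
      then show ?thesis using that by simp
    qed
    have quot: "(\<lambda>n. (\<phi> (p n (Suc (j n))) - \<phi> (p n (j n))) / (p n (Suc (j n)) - p n (j n))) \<longlonglongrightarrow> - neg_slope s"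
    proof (rule DERIV_straddle[OF d _ _ _ lima limb])
      show "p n (j n) \<le> s" "s \<le> p n (Suc (j n))" "p n (j n) < p n (Suc (j n))" for n
        using j[of n] by auto
    qed
    have limm: "(\<lambda>n. m n (j n)) \<longlonglongrightarrow> I s"
    proof (rule order_tendstoI)
      fix y assume y: "I s < y"
      show "\<forall>\<^sub>F n in sequentially. m n (j n) < y" using ev
      proof eventually_elim
        case (elim n)
        then have "m n (j n) \<le> I s" using m_le[of "j n" n s] j[of n] by auto
        then show ?case using y by simp
      qed
    next
      fix y assume y: "y < I s"
      define z where "z = (y + I s) / 2"
      have z: "y < z" "z < I s" using y by (auto simp: z_def)
      have "continuous (at s within {0..1}) I" using continuous_I s by (simp add: continuous_on_eq_continuous_within)
      then have "(I \<longlongrightarrow> I s) (at s within {0..1})" by (simp add: continuous_within)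
      then have "\<forall>\<^sub>F r in at s within {0..1}. z < I r" using z(2) by (rule order_tendstoD)
      then obtain \<delta> where \<delta>: "0 < \<delta>" "\<And>r. r \<in> {0..1} \<Longrightarrow> r \<noteq> s \<Longrightarrow> dist r s < \<delta> \<Longrightarrow> z < I r"
        unfolding eventually_at by blast
      have "\<forall>\<^sub>F n in sequentially. s - \<delta> < p n (j n)" "\<forall>\<^sub>F n in sequentially. p n (Suc (j n)) < s + \<delta>"
        using lima limb \<delta>(1) by (auto intro: order_tendstoD)
      with ev show "\<forall>\<^sub>F n in sequentially. y < m n (j n)"
      proof eventually_elim
        case (elim n)
        have "z \<le> m n (j n)" unfolding m_def
        proof (rule cINF_greatest[OF m_ne])
          fix r assume r: "r \<in> {p n (j n)..p n (Suc (j n))}"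
          then have "r \<in> {0..1}" using m_range[of "j n" n] elim by auto
          moreover have "dist r s < \<delta>" using r elim by (auto simp: dist_real_def)
          ultimately show "z \<le> I r" using \<delta>(2)[of r] z by (cases "r = s") auto
        qed
        then show ?case using z by simp
      qed
    qed
    have "(\<lambda>n. m n (j n) * (- ((\<phi> (p n (Suc (j n))) - \<phi> (p n (j n))) / (p n (Suc (j n)) - p n (j n)))) - k)
       \<longlonglongrightarrow> I s * (- (- neg_slope s)) - k"
      by (intro tendsto_intros limm quot)
    also have "(\<lambda>n. m n (j n) * (- ((\<phi> (p n (Suc (j n))) - \<phi> (p n (j n))) / (p n (Suc (j n)) - p n (j n)))) - k)
      = (\<lambda>n. \<gamma> n (j n) - k)"
      unfolding \<gamma>_def p_step by (simp add: field_simps)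
    finally have "(\<lambda>n. ennreal (\<gamma> n (j n) - k)) \<longlonglongrightarrow> ennreal (neg_slope s * I s - k)"
      by (intro tendsto_ennrealI) (simp add: mult.commute)
    moreover have "\<forall>\<^sub>F n in sequentially. ennreal (\<gamma> n (j n) - k) = P n s"
      using ev by eventually_elim (simp add: Peq)
    ultimately show ?thesis by (rule Lim_transform_eventually)
  qed
  have "(\<integral>\<^sup>+s\<in>{0<..<1}. ennreal (neg_slope s * I s - k) \<partial>lborel) \<le> (\<integral>\<^sup>+s. liminf (\<lambda>n. P n s) \<partial>lborel)"
  proof (rule nn_integral_mono_AE)
    show "AE s in lborel. ennreal (neg_slope s * I s - k) * indicator {0<..<1} s \<le> liminf (\<lambda>n. P n s)"
      using AE_rearr_differentiable
    proof eventually_elim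
      case (elim s)
      show ?case
      proof (cases "0 < s \<and> s < 1")
        case True
        then have "liminf (\<lambda>n. P n s) = ennreal (neg_slope s * I s - k)"
          using elim by (intro lim_imp_Liminf lim) auto
        then show ?thesis by (simp add: indicator_def)
      qed (auto simp: indicator_def)
    qed
  qed
  also have "\<dots> \<le> liminf (\<lambda>n. \<integral>\<^sup>+s. P n s \<partial>lborel)" by (rule nn_integral_liminf) measurable
  also have "\<dots> \<le> liminf (\<lambda>n. \<integral>\<^sup>+x. ennreal (H x - k) \<partial>M)" by (rule Liminf_mono) (simp add: P_le)
  also have "\<dots> = (\<integral>\<^sup>+x. ennreal (H x - k) \<partial>M)" by (rule Liminf_const) simp
  finally show ?thesis .
qed


abbreviation unit_lborel :: "real measure" where
  "unit_lborel \<equiv> restrict_space lborel {0<..<1}"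

lemma prob_space_unit_lborel: "prob_space unit_lborel"
  by (rule prob_spaceI) (simp add: space_restrict_space emeasure_restrict_space)

text \<open>A Borel version of \<open>(-\<phi>') I\<close>.\<close>

definition G :: "real \<Rightarrow> real" where
  "G s = neg_slope s * (I s * indicator {0<..<1} s)"

lemma measurable_G[measurable]: "G \<in> borel_measurable borel"
proof -
  have "(\<lambda>s. indicator {0<..<1} s *\<^sub>R I s) \<in> borel_measurable borel"
    by (rule borel_measurable_continuous_on_indicator)
      (auto intro: continuous_on_subset[OF continuous_I])
  then have [measurable]: "(\<lambda>s. I s * indicator {0<..<1} s) \<in> borel_measurable borel"
    by (simp add: mult.commute)
  show ?thesis unfolding G_def[abs_def] by measurable
qed

lemma measurable_G_unit: "G \<in> borel_measurable unit_lborel"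
  by (rule measurable_restrict_space1) simp

lemma AE_G_nonneg: "AE s in lborel. 0 \<le> G s"
  using AE_rearr_differentiable
  by eventually_elim (auto simp: G_def indicator_def I_nonneg)

text \<open>The values of \<open>deriv\<close> where \<open>\<phi>\<close> is not differentiable only affect a Lebesgue null set, so both
  functions have the same distribution function.\<close>

lemma rearr_deriv_eq_rearr_G:
  "rearr (lebesgue_on {0<..<1}) (\<lambda>r. deriv (\<lambda>v. - \<phi> v) r * I r) s = rearr unit_lborel G s"
proof -
  define U where "U r = deriv (\<lambda>v. - \<phi> v) r * I r" for r
  have UG: "AE s in lebesgue. s \<in> {0<..<1} \<longrightarrow> U s = G s"
  proof -
    have "AE s in lborel. s \<in> {0<..<1} \<longrightarrow> U s = G s"
      using AE_rearr_differentiable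
    proof eventually_elim
      case (elim s)
      show ?case
      proof
        assume s: "s \<in> {0<..<1}"
        then have "((\<lambda>v. - \<phi> v) has_real_derivative - (- neg_slope s)) (at s)"
          using elim by (intro DERIV_minus) auto
        then have "deriv (\<lambda>v. - \<phi> v) s = neg_slope s" using DERIV_imp_deriv by fastforce
        then show "U s = G s" using s by (simp add: U_def G_def)
      qed
    qed
    then show ?thesis by (rule AE_completion)
  qed
  have "distr_fun (lebesgue_on {0<..<1}) U c = distr_fun unit_lborel G c" for c
  proof -
    define E where "E = {s \<in> {0<..<1}. c < \<bar>U s\<bar>}"
    define F where "F = {s \<in> {0<..<1}. c < \<bar>G s\<bar>}"
    have F: "F \<in> sets borel" unfolding F_def by measurable
    then have FL: "F \<in> sets lebesgue" by simp
    have neg: "negligible ((F - E) \<union> (E - F))"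
    proof -
      obtain N where N: "N \<in> null_sets lebesgue" "{s \<in> space lebesgue. \<not> (s \<in> {0<..<1} \<longrightarrow> U s = G s)} \<subseteq> N"
        using UG unfolding eventually_ae_filter by blast
      have "(F - E) \<union> (E - F) \<subseteq> N" using N(2) by (auto simp: E_def F_def)
      then show ?thesis using N(1) negligible_subset negligible_iff_null_sets by blast
    qed
    have EL: "E \<in> sets lebesgue" by (rule sets_negligible_symdiff[OF FL neg])
    have "measure lebesgue E = measure lebesgue F"
    proof (rule measure_eq_AE[OF _ EL FL])
      show "AE s in lebesgue. (s \<in> E) = (s \<in> F)" using UG
        by eventually_elim (auto simp: E_def F_def)
    qed
    moreover have "distr_fun (lebesgue_on {0<..<1}) U c = measure lebesgue E"
      unfolding distr_fun_def space_lebesgue_on E_def by (rule measure_restrict_space) auto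
    moreover have "distr_fun unit_lborel G c = measure lborel F"
    proof -
      have "distr_fun unit_lborel G c = measure unit_lborel F"
        by (simp add: distr_fun_def F_def space_restrict_space)
      also have "\<dots> = measure lborel F"
        by (rule measure_restrict_space) (auto simp: F_def)
      finally show ?thesis .
    qed
    ultimately show ?thesis using F by (simp add: measure_completion)
  qed
  then show ?thesis by (simp add: rearr_def U_def[abs_def])
qed

text \<open>By equimeasurability \<open>excess_slope_integral_le\<close> is a statement about the rearrangements of \<open>G\<close>
  and \<open>H\<close>, and there it is the hypothesis of \<open>hardy_littlewood_polya_powr\<close>.\<close>

lemma majorization:
  assumes "1 \<le> q" and t: "0 < t" "t < 1"
  shows "(\<integral>\<^sup>+s\<in>{0<..<t}. ennreal (rearr unit_lborel G s powr q) \<partial>lborel)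
    \<le> (\<integral>\<^sup>+s\<in>{0<..<t}. ennreal (rearr M H s powr q) \<partial>lborel)"
proof -
  interpret P: prob_space unit_lborel by (rule prob_space_unit_lborel)
  note finP = P.finite_measure_axioms
  define A where "A s = rearr unit_lborel G s * indicator {0<..<1} s" for s
  define B where "B s = rearr M H s * indicator {0<..<1} s" for s
  have "(\<integral>\<^sup>+s\<in>{0<..<t}. ennreal (A s powr q) \<partial>lborel) \<le> (\<integral>\<^sup>+s\<in>{0<..<t}. ennreal (B s powr q) \<partial>lborel)"
  proof (rule hardy_littlewood_polya_powr[where L = L])
    show "A \<in> borel_measurable borel" unfolding A_def[abs_def]
      by (rule borel_measurable_rearr[OF finP measurable_G_unit])
    show "B \<in> borel_measurable borel" unfolding B_def[abs_def]
      by (rule borel_measurable_rearr[OF finite_measure_axioms measurable_H])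
    show "0 \<le> A s" if "0 < s" "s < 1" for s
      using that rearr_nonneg[OF finP measurable_G_unit] by (simp add: A_def)
    show "0 \<le> B s" if "0 < s" "s < 1" for s
      using that rearr_nonneg[OF finite_measure_axioms measurable_H] by (simp add: B_def)
    show "A r \<le> A s" if "0 < s" "s \<le> r" "r < 1" for s r
      using that rearr_antimono[OF finP measurable_G_unit] by (simp add: A_def)
    show "B r \<le> B s" if "0 < s" "s \<le> r" "r < 1" for s r
      using that rearr_antimono[OF finite_measure_axioms measurable_H] by (simp add: B_def)
    show "B s \<le> L" if "0 < s" "s < 1" for s
      using that rearr_le_bound[OF finite_measure_axioms measurable_H] L_nonneg H_le H_nonneg by (simp add: B_def)
    show "(\<integral>\<^sup>+s\<in>{0<..<1}. ennreal (A s - k) \<partial>lborel) \<le> (\<integral>\<^sup>+s\<in>{0<..<1}. ennreal (B s - k) \<partial>lborel)"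
      if k: "0 \<le> k" for k
    proof -
      have "(\<integral>\<^sup>+s\<in>{0<..<1}. ennreal (A s - k) \<partial>lborel) = (\<integral>\<^sup>+s\<in>{0<..<1}. ennreal (rearr unit_lborel G s - k) \<partial>lborel)"
        by (intro nn_integral_cong) (auto simp: A_def indicator_def)
      also have "\<dots> = (\<integral>\<^sup>+s. ennreal (\<bar>G s\<bar> - k) \<partial>unit_lborel)"
        by (rule nn_integral_rearr[OF prob_space_unit_lborel measurable_G_unit]) measurable
      also have "\<dots> = (\<integral>\<^sup>+s\<in>{0<..<1}. ennreal (\<bar>G s\<bar> - k) \<partial>lborel)"
        by (simp add: nn_integral_restrict_space)
      also have "\<dots> = (\<integral>\<^sup>+s\<in>{0<..<1}. ennreal (neg_slope s * I s - k) \<partial>lborel)"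
        using AE_G_nonneg
        by (intro nn_integral_cong_AE, elim eventually_mono) (auto simp: G_def indicator_def)
      also have "\<dots> \<le> (\<integral>\<^sup>+x. ennreal (H x - k) \<partial>M)" by (rule excess_slope_integral_le[OF k])
      also have "\<dots> = (\<integral>\<^sup>+x. ennreal (\<bar>H x\<bar> - k) \<partial>M)" by (simp add: H_nonneg)
      also have "\<dots> = (\<integral>\<^sup>+s\<in>{0<..<1}. ennreal (rearr M H s - k) \<partial>lborel)"
        by (rule nn_integral_rearr[OF prob_M measurable_H, symmetric]) measurable
      also have "\<dots> = (\<integral>\<^sup>+s\<in>{0<..<1}. ennreal (B s - k) \<partial>lborel)"
        by (intro nn_integral_cong) (auto simp: B_def indicator_def)
      finally show ?thesis .
    qed
  qed (use assms in auto)
  moreover have "(\<integral>\<^sup>+s\<in>{0<..<t}. ennreal (A s powr q) \<partial>lborel) = (\<integral>\<^sup>+s\<in>{0<..<t}. ennreal (rearr unit_lborel G s powr q) \<partial>lborel)"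
    using t by (intro nn_integral_cong) (auto simp: A_def indicator_def)
  moreover have "(\<integral>\<^sup>+s\<in>{0<..<t}. ennreal (B s powr q) \<partial>lborel) = (\<integral>\<^sup>+s\<in>{0<..<t}. ennreal (rearr M H s powr q) \<partial>lborel)"
    using t by (intro nn_integral_cong) (auto simp: B_def indicator_def)
  ultimately show ?thesis by simp
qed

text \<open>Among all sets of measure \<open>t\<close>, none gives \<open>|G|\<^sup>q\<close> a larger integral than the rearrangement has over
  \<open>(0,t)\<close>; then \<open>majorization\<close> applies.\<close>

lemma G_powr_integral_le:
  assumes q: "1 \<le> q" and t: "0 < t" "t < 1"
  shows "(\<integral>\<^sup>+s\<in>{0<..<t}. ennreal (\<bar>G s\<bar> powr q) \<partial>lborel) \<le> (\<integral>\<^sup>+s\<in>{0<..<t}. ennreal (rearr M H s powr q) \<partial>lborel)"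
proof -
  have E: "{0<..<t} \<in> sets unit_lborel" using t by (simp add: sets_restrict_space_iff) auto
  have "(\<integral>\<^sup>+s\<in>{0<..<t}. ennreal (\<bar>G s\<bar> powr q) \<partial>lborel) = (\<integral>\<^sup>+s\<in>{0<..<t}. ennreal (\<bar>G s\<bar> powr q) \<partial>unit_lborel)"
    using t by (simp add: nn_integral_restrict_space) (auto intro!: nn_integral_cong simp: indicator_def)
  also have "\<dots> \<le> (\<integral>\<^sup>+s\<in>{0<..<t}. ennreal (rearr unit_lborel G s powr q) \<partial>lborel)"
  proof (rule nn_integral_le_rearr[OF prob_space_unit_lborel measurable_G_unit])
    show "(\<lambda>x. ennreal (x powr q)) \<in> borel_measurable borel" by measurable
    show "ennreal (x powr q) \<le> ennreal (y powr q)" if "0 \<le> x" "x \<le> y" for x y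
      using that q by (intro ennreal_leI powr_mono2) auto
    show "measure unit_lborel {0<..<t} \<le> t"
      using t by (subst measure_restrict_space) auto
  qed (use E q in auto)
  also have "\<dots> \<le> (\<integral>\<^sup>+s\<in>{0<..<t}. ennreal (rearr M H s powr q) \<partial>lborel)"
    by (rule majorization[OF assms])
  finally show ?thesis .
qed

text \<open>Write \<open>\<phi> s - \<phi> t\<close> as the integral of the slope over \<open>[s,t]\<close> and exchange the order of
  integration: the slope at \<open>r\<close> is counted for all \<open>s \<le> r\<close>, that is, with weight \<open>r\<close>.\<close>

lemma excess_average_le:
  assumes f: "integrable M f" and t: "0 < t" "t < 1"
  shows "ennreal (t * (rearr_avg M f t - \<phi> t)) \<le> (\<integral>\<^sup>+r\<in>{0<..<t}. ennreal (r * neg_slope r) \<partial>lborel)"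
    and "0 \<le> t * (rearr_avg M f t - \<phi> t)"
proof -
  define B where "B s = \<phi> s * indicator {0<..<1} s" for s
  have B[measurable]: "B \<in> borel_measurable borel" unfolding B_def[abs_def]
    by (rule borel_measurable_rearr[OF finite_measure_axioms measurable_f])
  have \<phi>B: "indicator {0<..<t} s *\<^sub>R \<phi> s = indicator {0<..<t} s *\<^sub>R B s" for s
    using t by (simp add: B_def indicator_def)
  have int: "set_integrable lborel {0<..<t} \<phi>"
  proof -
    have "integrable lborel (\<lambda>s. indicator {0<..<t} s *\<^sub>R B s)"
    proof (rule integrableI_bounded)
      have "(\<integral>\<^sup>+s. ennreal (norm (indicator {0<..<t} s *\<^sub>R B s)) \<partial>lborel) \<le> (\<integral>\<^sup>+s\<in>{0<..<1}. ennreal (\<phi> s) \<partial>lborel)"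
        using t \<phi>_nonneg by (intro nn_integral_mono) (auto simp: B_def indicator_def)
      also have "\<dots> = (\<integral>\<^sup>+x. ennreal \<bar>f x\<bar> \<partial>M)" by (rule nn_integral_rearr[OF prob_M measurable_f]) measurable
      also have "\<dots> < \<infinity>" using f by (simp add: integrable_iff_bounded)
      finally show "(\<integral>\<^sup>+s. ennreal (norm (indicator {0<..<t} s *\<^sub>R B s)) \<partial>lborel) < \<infinity>" .
    qed measurable
    then show ?thesis unfolding set_integrable_def \<phi>B .
  qed
  have intc: "set_integrable lborel {0<..<t} (\<lambda>_. \<phi> t)"
    using t by (simp add: set_integrable_def)
  have avg: "t * (rearr_avg M f t - \<phi> t) = (LINT s:{0<..<t}|lborel. \<phi> s - \<phi> t)"
  proof -
    have "(LINT s:{0<..<t}|lborel. \<phi> s - \<phi> t) = (LINT s:{0<..<t}|lborel. \<phi> s) - (LINT s:{0<..<t}|lborel. \<phi> t)"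
      by (rule set_integral_diff(2)[OF int intc])
    also have "(LINT s:{0<..<t}|lborel. \<phi> t) = t * \<phi> t"
      using t by (simp add: set_lebesgue_integral_def)
    also have "(LINT s:{0<..<t}|lborel. \<phi> s) = t * rearr_avg M f t"
      using t by (simp add: rearr_avg_def)
    finally show ?thesis by (simp add: algebra_simps)
  qed
  have nn: "0 \<le> indicator {0<..<t} s *\<^sub>R (\<phi> s - \<phi> t)" for s
    using \<phi>_antimono[of s t] by (simp add: indicator_def)
  show "0 \<le> t * (rearr_avg M f t - \<phi> t)"
    unfolding avg set_lebesgue_integral_def by (rule Bochner_Integration.integral_nonneg) (rule nn)
  have "ennreal (t * (rearr_avg M f t - \<phi> t)) = (\<integral>\<^sup>+s. ennreal (indicator {0<..<t} s *\<^sub>R (\<phi> s - \<phi> t)) \<partial>lborel)"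
    unfolding avg set_lebesgue_integral_def
    by (rule nn_integral_eq_integral[symmetric])
      (use set_integral_diff(1)[OF int intc] nn in \<open>auto simp: set_integrable_def\<close>)
  also have "\<dots> = (\<integral>\<^sup>+s. (\<integral>\<^sup>+r. ennreal (neg_slope r) * (if 0 < s \<and> s < t \<and> s \<le> r \<and> r \<le> t then 1 else 0) \<partial>lborel) \<partial>lborel)"
  proof (rule nn_integral_cong)
    fix s
    show "ennreal (indicator {0<..<t} s *\<^sub>R (\<phi> s - \<phi> t)) = (\<integral>\<^sup>+r. ennreal (neg_slope r) * (if 0 < s \<and> s < t \<and> s \<le> r \<and> r \<le> t then 1 else 0) \<partial>lborel)"
    proof (cases "0 < s \<and> s < t")
      case True
      then have "ennreal (\<phi> s - \<phi> t) = (\<integral>\<^sup>+r\<in>{s..t}. ennreal (neg_slope r) \<partial>lborel)"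
        using t by (intro rearr_drop_eq_integral) auto
      also have "\<dots> = (\<integral>\<^sup>+r. ennreal (neg_slope r) * (if 0 < s \<and> s < t \<and> s \<le> r \<and> r \<le> t then 1 else 0) \<partial>lborel)"
        using True by (intro nn_integral_cong) (auto simp: indicator_def)
      finally show ?thesis using True by (simp add: indicator_def)
    qed (auto simp: indicator_def)
  qed
  also have "\<dots> = (\<integral>\<^sup>+r. (\<integral>\<^sup>+s. ennreal (neg_slope r) * (if 0 < s \<and> s < t \<and> s \<le> r \<and> r \<le> t then 1 else 0) \<partial>lborel) \<partial>lborel)"
    by (rule lborel_pair.Fubini') measurable
  also have "\<dots> \<le> (\<integral>\<^sup>+r\<in>{0<..<t}. ennreal (r * neg_slope r) \<partial>lborel)"
  proof (rule nn_integral_mono_AE)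
    show "AE r in lborel. (\<integral>\<^sup>+s. ennreal (neg_slope r) * (if 0 < s \<and> s < t \<and> s \<le> r \<and> r \<le> t then 1 else 0) \<partial>lborel)
        \<le> ennreal (r * neg_slope r) * indicator {0<..<t} r"
      using AE_lborel_singleton[of t] AE_rearr_differentiable
    proof eventually_elim
      case (elim r)
      show ?case
      proof (cases "0 < r \<and> r < t")
        case True
        have "(\<integral>\<^sup>+s. ennreal (neg_slope r) * (if 0 < s \<and> s < t \<and> s \<le> r \<and> r \<le> t then 1 else 0) \<partial>lborel)
          = (\<integral>\<^sup>+s. ennreal (neg_slope r) * indicator {0<..r} s \<partial>lborel)"
          using True by (intro nn_integral_cong) (auto simp: indicator_def)
        also have "\<dots> = ennreal (neg_slope r) * ennreal r"
          using True by (subst nn_integral_cmult_indicator) auto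
        also have "\<dots> = ennreal (r * neg_slope r)"
          using True elim t by (simp add: ennreal_mult mult.commute)
        finally show ?thesis using True by (simp add: indicator_def)
      next
        case False
        then have "\<not> (0 < s \<and> s < t \<and> s \<le> r \<and> r \<le> t)" for s using elim by auto
        then show ?thesis by (simp add: if_not_P)
      qed
    qed
  qed
  finally show "ennreal (t * (rearr_avg M f t - \<phi> t)) \<le> (\<integral>\<^sup>+r\<in>{0<..<t}. ennreal (r * neg_slope r) \<partial>lborel)" .
qed

text \<open>For \<open>q = 1\<close> the weight \<open>w\<close> satisfies \<open>w r \<le> I r\<close>, so \<open>w r neg_slope r \<le> G r\<close>.  For \<open>q > 1\<close> factor
  \<open>r neg_slope r = (r / I r) G r\<close> and apply Hoelder's inequality; the integral of \<open>(r / I r)\<^sup>p\<close> is \<open>t\<close> times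
  the average whose power \<open>-1/p\<close> defines the weight.\<close>

lemma weighted_oscillation_le:
  assumes f: "integrable M f" and q: "1 \<le> q" and t: "0 < t" "t < 1"
  shows "(rearr_avg M f t - \<phi> t) * isoperimetric_weight I q t
     \<le> ((1 / t) * (LINT s:{0<..<t}|lborel. rearr M H s powr q)) powr (1 / q)"
proof -
  define b where "b = (LINT s:{0<..<t}|lborel. rearr M H s powr q)"
  define \<Delta> where "\<Delta> = t * (rearr_avg M f t - \<phi> t)"
  have \<Delta>: "ennreal \<Delta> \<le> (\<integral>\<^sup>+r\<in>{0<..<t}. ennreal (r * neg_slope r) \<partial>lborel)" "0 \<le> \<Delta>"
    unfolding \<Delta>_def by (rule excess_average_le[OF f t])+
  have \<Delta>eq: "rearr_avg M f t - \<phi> t = \<Delta> / t" using t by (simp add: \<Delta>_def)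
  define B where "B s = rearr M H s * indicator {0<..<1} s" for s
  have B[measurable]: "B \<in> borel_measurable borel" unfolding B_def[abs_def]
    by (rule borel_measurable_rearr[OF finite_measure_axioms measurable_H])
  have HB: "indicator {0<..<t} s *\<^sub>R (rearr M H s powr q) = indicator {0<..<t} s *\<^sub>R (B s powr q)" for s
    using t by (simp add: B_def indicator_def)
  have b: "ennreal b = (\<integral>\<^sup>+s\<in>{0<..<t}. ennreal (rearr M H s powr q) \<partial>lborel)" "0 \<le> b"
  proof -
    have int: "integrable lborel (\<lambda>s. indicator {0<..<t} s *\<^sub>R (B s powr q))"
    proof (rule Bochner_Integration.integrable_bound)
      show "integrable lborel (\<lambda>s. indicator {0<..<t} s *\<^sub>R (L powr q))" using t by simp
      show "AE s in lborel. norm (indicator {0<..<t} s *\<^sub>R (B s powr q)) \<le> norm (indicator {0<..<t} s *\<^sub>R (L powr q))"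
      proof (intro AE_I2)
        fix s
        have "B s powr q \<le> L powr q" if "0 < s" "s < t"
          using that t q rearr_nonneg[OF finite_measure_axioms measurable_H, of s] L_nonneg H_le H_nonneg
            rearr_le_bound[OF finite_measure_axioms measurable_H, of s L]
          by (intro powr_mono2) (auto simp: B_def)
        then show "norm (indicator {0<..<t} s *\<^sub>R (B s powr q)) \<le> norm (indicator {0<..<t} s *\<^sub>R (L powr q))"
          by (auto simp: indicator_def)
      qed
    qed measurable
    have "(\<integral>\<^sup>+s\<in>{0<..<t}. ennreal (rearr M H s powr q) \<partial>lborel) = (\<integral>\<^sup>+s. ennreal (indicator {0<..<t} s *\<^sub>R (B s powr q)) \<partial>lborel)"
      using t by (intro nn_integral_cong) (auto simp: B_def indicator_def)
    also have "\<dots> = ennreal (\<integral>s. indicator {0<..<t} s *\<^sub>R (B s powr q) \<partial>lborel)"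
      by (rule nn_integral_eq_integral[OF int]) auto
    also have "(\<integral>s. indicator {0<..<t} s *\<^sub>R (B s powr q) \<partial>lborel) = b"
      unfolding b_def set_lebesgue_integral_def HB ..
    finally show "ennreal b = (\<integral>\<^sup>+s\<in>{0<..<t}. ennreal (rearr M H s powr q) \<partial>lborel)" ..
    show "0 \<le> b" unfolding b_def set_lebesgue_integral_def by (rule Bochner_Integration.integral_nonneg) simp
  qed
  have Gb: "(\<integral>\<^sup>+s\<in>{0<..<t}. ennreal (\<bar>G s\<bar> powr q) \<partial>lborel) \<le> ennreal b"
    unfolding b(1) by (rule G_powr_integral_le[OF q t])
  have goal: "\<Delta> / t * isoperimetric_weight I q t \<le> ((1 / t) * b) powr (1 / q)"
  proof (cases "q = 1")
    case True
    define w where "w = isoperimetric_weight I q t"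
    have bdd: "bdd_below ((\<lambda>s. I s / s) ` {0<..<t})"
      using I_nonneg t by (intro bdd_belowI2[of _ 0]) auto
    have w: "w = (INF s\<in>{0<..<t}. I s / s)" using True by (simp add: w_def isoperimetric_weight_def)
    have w0: "0 \<le> w" unfolding w using t I_nonneg by (intro cINF_greatest) auto
    have wI: "w * r \<le> I r" if "0 < r" "r < t" for r
    proof -
      have "w \<le> I r / r" unfolding w using that by (intro cINF_lower bdd) auto
      then show ?thesis using that by (simp add: field_simps)
    qed
    have "ennreal (w * \<Delta>) = ennreal w * ennreal \<Delta>" using w0 \<Delta>(2) by (simp add: ennreal_mult)
    also have "\<dots> \<le> ennreal w * (\<integral>\<^sup>+r\<in>{0<..<t}. ennreal (r * neg_slope r) \<partial>lborel)"
      by (intro mult_left_mono \<Delta>) simp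
    also have "\<dots> = (\<integral>\<^sup>+r. ennreal w * (ennreal (r * neg_slope r) * indicator {0<..<t} r) \<partial>lborel)"
      by (rule nn_integral_cmult[symmetric]) measurable
    also have "\<dots> \<le> (\<integral>\<^sup>+s\<in>{0<..<t}. ennreal (\<bar>G s\<bar> powr q) \<partial>lborel)"
    proof (rule nn_integral_mono_AE)
      show "AE r in lborel. ennreal w * (ennreal (r * neg_slope r) * indicator {0<..<t} r) \<le> ennreal (\<bar>G r\<bar> powr q) * indicator {0<..<t} r"
        using AE_rearr_differentiable
      proof eventually_elim
        case (elim r)
        show ?case
        proof (cases "0 < r \<and> r < t")
          case True
          then have D: "0 \<le> neg_slope r" using elim t by auto
          have "w * (r * neg_slope r) \<le> neg_slope r * I r"
            using mult_right_mono[OF wI D, of r] True by (simp add: mult_ac)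
          also have "\<dots> \<le> \<bar>G r\<bar> powr q" using True t \<open>q = 1\<close> by (simp add: G_def)
          finally have "ennreal (w * (r * neg_slope r)) \<le> ennreal (\<bar>G r\<bar> powr q)" by (rule ennreal_leI)
          then show ?thesis using True w0 D by (simp add: ennreal_mult indicator_def)
        qed (auto simp: indicator_def)
      qed
    qed
    also note Gb
    finally have "w * \<Delta> \<le> b" using b(2) by (simp add: ennreal_le_iff)
    then have "\<Delta> / t * w \<le> b / t" using t by (simp add: divide_right_mono mult.commute)
    then show ?thesis using True t b(2) by (simp add: w_def)
  next
    case False
    then have q1: "1 < q" using q by simp
    define p where "p = q / (q - 1)"
    have p: "1 < p" "1/p + 1/q = 1" "1/p = (q - 1)/q" using q1 by (auto simp: p_def field_simps)
    define J where "J = (\<integral>\<^sup>+s\<in>{0<..<t}. ennreal ((s / I s) powr p) \<partial>lborel)"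
    have w: "isoperimetric_weight I q t = (if J = \<infinity> then 0 else ((1 / t) * enn2real J) powr (- (1/p)))"
      using False by (simp add: isoperimetric_weight_def J_def p_def Let_def minus_divide_left)
    show ?thesis
    \<comment> \<open>in both cases the weight is \<open>0\<close>, for \<open>J = 0\<close> because \<open>0 powr x = 0\<close>\<close>
    proof (cases "J = \<infinity> \<or> J = 0")
      case True
      then show ?thesis using w by auto
    next
      case False
      then obtain j where j: "J = ennreal j" "0 < j" by (cases J) (auto simp: less_le)
      define X where "X s = s / (I s * indicator {0<..<1} s) * indicator {0<..<t} s" for s
      define Y where "Y s = \<bar>G s\<bar> * indicator {0<..<t} s" for s
      have [measurable]: "(\<lambda>s. I s * indicator {0<..<1} s) \<in> borel_measurable borel"
      proof -
        have "(\<lambda>s. indicator {0<..<1} s *\<^sub>R I s) \<in> borel_measurable borel"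
          by (rule borel_measurable_continuous_on_indicator)
            (auto intro: continuous_on_subset[OF continuous_I])
        then show ?thesis by (simp add: mult.commute)
      qed
      have Xm[measurable]: "X \<in> borel_measurable borel" unfolding X_def[abs_def] by measurable
      have Ym[measurable]: "Y \<in> borel_measurable borel" unfolding Y_def[abs_def] by measurable
      have JX: "(\<integral>\<^sup>+s. ennreal (X s powr p) \<partial>lborel) = ennreal j"
        unfolding j(1)[symmetric] J_def using t by (intro nn_integral_cong) (auto simp: X_def indicator_def)
      have VY: "(\<integral>\<^sup>+s. ennreal (Y s powr q) \<partial>lborel) = (\<integral>\<^sup>+s\<in>{0<..<t}. ennreal (\<bar>G s\<bar> powr q) \<partial>lborel)"
        by (intro nn_integral_cong) (auto simp: Y_def indicator_def)
      then obtain v where v: "(\<integral>\<^sup>+s. ennreal (Y s powr q) \<partial>lborel) = ennreal v" "0 \<le> v" "v \<le> b"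
      proof -
        have "(\<integral>\<^sup>+s. ennreal (Y s powr q) \<partial>lborel) \<le> ennreal b" using Gb VY by simp
        then show ?thesis using that b(2)
          by (cases "\<integral>\<^sup>+s. ennreal (Y s powr q) \<partial>lborel") (auto simp: ennreal_le_iff top_unique)
      qed
      have "ennreal \<Delta> \<le> (\<integral>\<^sup>+r\<in>{0<..<t}. ennreal (r * neg_slope r) \<partial>lborel)" by (rule \<Delta>)
      also have "\<dots> \<le> (\<integral>\<^sup>+r. ennreal (X r * Y r) \<partial>lborel)"
      proof (rule nn_integral_mono)
        fix r
        show "ennreal (r * neg_slope r) * indicator {0<..<t} r \<le> ennreal (X r * Y r)"
        proof (cases "0 < r \<and> r < t")
          case True
          then have I: "0 < I r" using positive_I[of r] t by simp
          have "r * neg_slope r \<le> r * \<bar>neg_slope r\<bar>" using True by (intro mult_left_mono) auto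
          also have "\<dots> = X r * Y r" using True t I by (simp add: X_def Y_def G_def abs_mult)
          finally show ?thesis using True by (simp add: indicator_def ennreal_leI)
        qed (auto simp: indicator_def)
      qed
      also have "\<dots> \<le> ennreal (j powr (1/p) * v powr (1/q))"
      proof (rule nn_integral_Holder[OF _ _ _ _ q1 p_def JX _ v(1,2)])
        show "0 \<le> X s" for s using t I_nonneg[of s] by (auto simp: X_def indicator_def)
        show "0 \<le> Y s" for s by (simp add: Y_def)
      qed (use j in auto)
      finally have "\<Delta> \<le> j powr (1/p) * v powr (1/q)" by (simp add: ennreal_le_iff)
      also have "\<dots> \<le> j powr (1/p) * b powr (1/q)"
        using v q1 by (intro mult_left_mono powr_mono2) auto
      finally have \<Delta>j: "\<Delta> \<le> j powr (1/p) * b powr (1/q)" .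
      have "\<Delta> / t * isoperimetric_weight I q t = \<Delta> / t * (j / t) powr (- (1/p))"
        using w False j by (simp add: mult.commute)
      also have "\<dots> \<le> (j powr (1/p) * b powr (1/q)) / t * (j / t) powr (- (1/p))"
        using \<Delta>j t by (intro mult_right_mono divide_right_mono) auto
      also have "\<dots> = b powr (1/q) * (t powr (1/p) / t)"
        using j t by (simp add: powr_divide powr_minus field_simps)
      also have "t powr (1/p) / t = t powr (- (1/q))"
      proof -
        have "t powr (- (1/q)) = t powr (1/p - 1)" 
        proof -
          have "- (1/q) = 1/p - 1" using p(2) by linarith
          then show ?thesis by (simp only:)
        qed
        also have "\<dots> = t powr (1/p) / t" using t by (simp add: powr_diff)
        finally show ?thesis by simp
      qed
      also have "b powr (1/q) * t powr (- (1/q)) = ((1 / t) * b) powr (1/q)"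
        using t b(2) by (simp add: powr_divide powr_minus field_simps)
      finally show ?thesis .
    qed
  qed
  then show ?thesis unfolding \<Delta>eq b_def .
qed

end

section \<open>The two symmetrization inequalities\<close>

theorem theorem1:
  fixes M :: "'a::metric_space measure" and I :: "real \<Rightarrow> real"
    and q t :: real and f :: "'a \<Rightarrow> real"
  assumes space: "metric_probability_space M"
    and profile: "isoperimetric_profile M I"
    and cond1: "continuous_on {0..1} I" "\<forall>s\<in>{0<..<1}. 0 < I s" "I 0 = 0"
    and cond2: "\<forall>g\<in>(Lip :: ('a \<Rightarrow> real) set). \<forall>c. AE x in M. g x = c \<longrightarrow> grad_norm g x = 0"
    and q: "1 \<le> q"
    and f: "f \<in> Lip" "integrable M f"
    and t: "t \<in> {0<..<1}"
  shows "(\<integral>\<^sup>+s\<in>{0<..<t}.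
            ennreal (rearr (lebesgue_on {0<..<1})
                       (\<lambda>r. deriv (\<lambda>v. - rearr M f v) r * I r) s powr q) \<partial>lborel)
         \<le> (\<integral>\<^sup>+s\<in>{0<..<t}. ennreal (rearr M (grad_norm f) s powr q) \<partial>lborel)
         \<and>
         (rearr_avg M f t - rearr M f t) * isoperimetric_weight I q t
         \<le> ((1 / t) * (LINT s:{0<..<t}|lborel. rearr M (grad_norm f) s powr q)) powr (1 / q)"
proof -
  obtain L where L: "L-lipschitz_on UNIV f" using f(1) by (auto simp: Lip_def)
  interpret lipschitz_isoperimetric M I f L
  proof (rule lipschitz_isoperimetric.intro)
    show "prob_space M" "sets M = sets borel"
      using space by (simp_all add: metric_probability_space_def)
    show "isoperimetric_minorant M I"
      using profile by (simp add: isoperimetric_profile_def)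
    show "AE x in M. g x = c \<longrightarrow> grad_norm g x = 0" if "g \<in> Lip" for g c
      using cond2 that by blast
  qed (use cond1 L in simp_all)
  from t have t: "0 < t" "t < 1" by auto
  show ?thesis
    unfolding rearr_deriv_eq_rearr_G
    using majorization[OF q t] weighted_oscillation_le[OF f(2) q t] by (rule conjI)
qed

end
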